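(* Let $r\in\mathbb N$, $\bar n\ge m$, $n=\bar nr$, $\nu=w\mu$ with $w$ a probability density w.r.t. $\mu$ satisfying $w\ge\alpha w_m$ for some $\alpha\in(0,1]$, and $\mathbf x\sim(\gamma_{\bar n}^\nu)^{\otimes r}$ (so $\mathbf x\in\mathcal X^n$), using weighted least squares with weight $w$. Let $0<\delta<1$, $S_\delta=\{\lambda_{\min}(\mathbf G^w(\mathbf x))\ge1-\delta\}$ with $\mathbb P(S_\delta)>0$, $\beta=1+(\alpha^{-1}-1)\frac m{\bar n}$, $\xi=0$ if $\nu=\nu_m$ and $\xi=1$ if $\nu\ne\nu_m$. Then for every $f\in L^2_\mu$, with $\hat f_m=\hat P_{V_m}f$, $$\mathbb E(\|f-\hat f_m\|^2\mid S_\delta)\le\big(1+\mathbb P(S_\delta)^{-1}(1-\delta)^{-1}\beta\big)\inf_{g\in V_m}\|f-g\|^2,$$ $$\mathbb E(\|f-\hat f_m\|^2\mid S_\delta)\le\Big(1+\mathbb P(S_\delta)^{-1}(1-\delta)^{-2}\tfrac mn\alpha^{-1}(\beta+\xi m\alpha^{-1}+\beta\xi n)\Big)\inf_{g\in V_m}\|f-g\|^2.$$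
   Context: $\mathcal X$ is a Polish space with Borel probability measure $\mu$; $\|\cdot\|$ is the $L^2_\mu$ norm. $V_m\subset L^2_\mu$ has $L^2_\mu$-orthonormal basis $\varphi_1,\dots,\varphi_m$, $\boldsymbol\varphi=(\varphi_1,\dots,\varphi_m)^T$, $w_m(x)=\frac1m\|\boldsymbol\varphi(x)\|_2^2$, $\nu_m=w_m\mu$. For points $\mathbf x=(x_1,\dots,x_n)$ and weight $w$: $\|f\|_n^2=\frac1n\sum_iw(x_i)^{-1}f(x_i)^2$, $\Phi^w(\mathbf x)$ has rows $w(x_i)^{-1/2}\boldsymbol\varphi(x_i)^T$, $\mathbf G^w(\mathbf x)=\frac1n\Phi^w(\mathbf x)^T\Phi^w(\mathbf x)$, $\hat P_{V_m}f$ is the unique minimizer over $V_m$ of $\|f-g\|_n$. For $\bar n\ge m$, $\gamma_{\bar n}^\nu$ is the probability measure on $\mathcal X^{\bar n}$ with $d\gamma_{\bar n}^\nu(\mathbf x)=\frac{(\bar n-m)!}{\bar n!}\det(\Phi^w(\mathbf x)^T\Phi^w(\mathbf x))\,d\nu^{\otimes\bar n}(\mathbf x)$. *)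

theory Defs
  imports "HOL-Probability.Probability" "Jordan_Normal_Form.Char_Poly"
begin

definition L2sq :: "'a measure \<Rightarrow> ('a \<Rightarrow> real) \<Rightarrow> real" where
  "L2sq M f = (\<integral>x. (f x)\<^sup>2 \<partial>M)"

definition Vm :: "(nat \<Rightarrow> 'a \<Rightarrow> real) \<Rightarrow> nat \<Rightarrow> ('a \<Rightarrow> real) set" where
  "Vm \<phi> m = {g. \<exists>c :: nat \<Rightarrow> real. g = (\<lambda>x. \<Sum>i<m. c i * \<phi> i x)}"

definition wm :: "(nat \<Rightarrow> 'a \<Rightarrow> real) \<Rightarrow> nat \<Rightarrow> 'a \<Rightarrow> real" where
  "wm \<phi> m x = (1 / real m) * (\<Sum>i<m. (\<phi> i x)\<^sup>2)"

definition PhiTPhi :: "(nat \<Rightarrow> 'a \<Rightarrow> real) \<Rightarrow> nat \<Rightarrow> ('a \<Rightarrow> real) \<Rightarrow> nat \<Rightarrow> (nat \<Rightarrow> 'a) \<Rightarrow> real mat" where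
  "PhiTPhi \<phi> m w N xs = mat m m (\<lambda>(k, l). \<Sum>i<N. (1 / w (xs i)) * \<phi> k (xs i) * \<phi> l (xs i))"

definition Gram :: "(nat \<Rightarrow> 'a \<Rightarrow> real) \<Rightarrow> nat \<Rightarrow> ('a \<Rightarrow> real) \<Rightarrow> nat \<Rightarrow> (nat \<Rightarrow> 'a) \<Rightarrow> real mat" where
  "Gram \<phi> m w N xs = (1 / real N) \<cdot>\<^sub>m PhiTPhi \<phi> m w N xs"

definition lambda_min :: "real mat \<Rightarrow> real" where
  "lambda_min A = Min {k. eigenvalue A k}"

definition emp_norm2 :: "('a \<Rightarrow> real) \<Rightarrow> nat \<Rightarrow> (nat \<Rightarrow> 'a) \<Rightarrow> ('a \<Rightarrow> real) \<Rightarrow> real" where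
  "emp_norm2 w N xs f = (1 / real N) * (\<Sum>i<N. (1 / w (xs i)) * (f (xs i))\<^sup>2)"

definition wls :: "(nat \<Rightarrow> 'a \<Rightarrow> real) \<Rightarrow> nat \<Rightarrow> ('a \<Rightarrow> real) \<Rightarrow> nat \<Rightarrow> (nat \<Rightarrow> 'a) \<Rightarrow> ('a \<Rightarrow> real) \<Rightarrow> ('a \<Rightarrow> real)" where
  "wls \<phi> m w N xs f = (THE g. g \<in> Vm \<phi> m \<and>
      (\<forall>h \<in> Vm \<phi> m. emp_norm2 w N xs (\<lambda>x. f x - g x) \<le> emp_norm2 w N xs (\<lambda>x. f x - h x)))"

definition gamma_vs :: "'a measure \<Rightarrow> (nat \<Rightarrow> 'a \<Rightarrow> real) \<Rightarrow> nat \<Rightarrow> ('a \<Rightarrow> real) \<Rightarrow> nat \<Rightarrow> (nat \<Rightarrow> 'a) measure" where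
  "gamma_vs M \<phi> m w nbar = density (PiM {..<nbar} (\<lambda>_. density M w))
     (\<lambda>xs. ennreal (fact (nbar - m) / fact nbar * det (PhiTPhi \<phi> m w nbar xs)))"

text \<open>Flattening r blocks of nbar points into one sample of n = nbar * r points:
  point number i is point (i mod nbar) of block (i div nbar).\<close>
definition flatten :: "nat \<Rightarrow> (nat \<Rightarrow> nat \<Rightarrow> 'a) \<Rightarrow> nat \<Rightarrow> 'a" where
  "flatten nbar X i = X (i div nbar) (i mod nbar)"

definition cond_exp_event :: "'b measure \<Rightarrow> 'b set \<Rightarrow> ('b \<Rightarrow> real) \<Rightarrow> ennreal" where
  "cond_exp_event P S Z = (\<integral>\<^sup>+ x \<in> S. ennreal (Z x) \<partial>P) / emeasure P S"

end

theory Submission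
  imports Defs
begin

text \<open>
  Let \<open>h\<close> be the residual of the best approximation of \<open>f\<close>. On the event \<open>S\<close> the Gram matrix is bounded
  below by \<open>1 - \<delta>\<close>, so the excess error of the least squares estimator is at most
  \<open>(1 - \<delta>)\<^sup>-\<^sup>1 \<parallel>h\<parallel>\<^sub>n\<^sup>2\<close> and at most \<open>(1 - \<delta>)\<^sup>-\<^sup>2 \<Sum>\<^sub>k \<langle>\<phi>\<^sub>k, h\<rangle>\<^sub>n\<^sup>2\<close>; the expectations of these two quantities
  without conditioning are then enough.

  Expanding the determinant in the density of \<open>\<gamma>\<close> as a sum over injections \<open>\<iota>\<close> of the \<open>m\<close> basis
  functions into the points of a block gives the mean of linear and quadratic statistics of a block.
  For a fixed \<open>\<iota>\<close> the points outside its range are independent with law \<open>\<nu>\<close>, and orthonormality kills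
  all permutations but the identity (linear statistics) or the identity and one transposition
  (quadratic statistics). Linear statistics give \<open>E \<parallel>h\<parallel>\<^sub>n\<^sup>2 \<le> \<beta> \<parallel>h\<parallel>\<^sup>2\<close>. If \<open>\<nu> = \<nu>\<^sub>m\<close>, the statistics
  \<open>\<phi>\<^sub>k h / w\<close> are centred under \<open>\<gamma>\<close> and negatively correlated inside a block, which gives the bound with
  \<open>\<xi> = 0\<close>; otherwise Jensen's inequality \<open>\<Sum>\<^sub>k \<langle>\<phi>\<^sub>k, h\<rangle>\<^sub>n\<^sup>2 \<le> (m / \<alpha>) \<parallel>h\<parallel>\<^sub>n\<^sup>2\<close> already yields the term \<open>\<beta> n\<close>.
\<close>

subsection \<open>Smallest eigenvalue and determinant of symmetric matrices\<close>

text \<open>Vectors are functions on the naturals of which only the first \<open>m\<close> values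
  count; the sphere can then be treated in the product topology.\<close>

definition quad_form :: "real mat \<Rightarrow> nat \<Rightarrow> (nat \<Rightarrow> real) \<Rightarrow> real" where
  "quad_form A m x = (\<Sum>k<m. \<Sum>l<m. A $$ (k, l) * x k * x l)"

lemma quad_form_add:
  assumes "\<And>k l. k < m \<Longrightarrow> l < m \<Longrightarrow> A $$ (k, l) = A $$ (l, k)"
  shows "quad_form A m (\<lambda>i. x i + t * y i) =
    quad_form A m x + 2 * t * (\<Sum>k<m. y k * (\<Sum>l<m. A $$ (k, l) * x l)) + t\<^sup>2 * quad_form A m y"
proof -
  let ?B = "\<lambda>x y. \<Sum>k<m. \<Sum>l<m. A $$ (k, l) * x k * y l"
  have "?B x y = ?B y x"
    by (subst sum.swap) (auto intro!: sum.cong simp: assms)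
  moreover have "?B y x = (\<Sum>k<m. y k * (\<Sum>l<m. A $$ (k, l) * x l))"
    by (simp add: sum_distrib_left mult_ac)
  moreover have "quad_form A m (\<lambda>i. x i + t * y i) = ?B x x + t * ?B x y + t * ?B y x + t\<^sup>2 * ?B y y"
    unfolding quad_form_def sum_distrib_left sum.distrib[symmetric]
    by (intro sum.cong) (auto simp: algebra_simps power2_eq_square)
  ultimately show ?thesis
    by (simp add: quad_form_def)
qed

lemma quad_form_scale: "quad_form A m (\<lambda>i. t * x i) = t\<^sup>2 * quad_form A m x"
  unfolding quad_form_def sum_distrib_left
  by (intro sum.cong) (auto simp: power2_eq_square mult_ac)

text \<open>Padding with zeros confines the sphere to a product of intervals, compact by Tychonoff,
  in which it is cut out by closed conditions on the coordinates.\<close>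

lemma compact_sphere:
  "compact {x :: nat \<Rightarrow> real. (\<forall>i\<ge>m. x i = 0) \<and> (\<Sum>i<m. (x i)\<^sup>2) = 1}" (is "compact ?K")
proof -
  let ?B = "PiE UNIV (\<lambda>_::nat. {-1..1::real})"
  let ?C = "{x :: nat \<Rightarrow> real. (\<forall>i. m \<le> i \<longrightarrow> x i = 0) \<and> (\<Sum>i<m. (x i)\<^sup>2) = 1}"
  have "compactin (product_topology (\<lambda>_. euclidean) UNIV) ?B"
    by (subst compactin_PiE) auto
  then have "compact ?B"
    by (simp add: euclidean_product_topology)
  moreover have "closed ?C"
    by (intro closed_Collect_conj closed_Collect_all closed_Collect_imp closed_Collect_eq
          open_Collect_const continuous_intros continuous_on_product_coordinates)
  moreover have "?K = ?B \<inter> ?C"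
  proof -
    have "x i \<in> {-1..1}" if "x \<in> ?K" for x i
    proof (cases "i < m")
      case True
      have "(x i)\<^sup>2 \<le> (\<Sum>i<m. (x i)\<^sup>2)"
        using True by (intro member_le_sum) auto
      then have "(x i)\<^sup>2 \<le> 1\<^sup>2" using that by simp
      then show ?thesis
        by (simp only: abs_le_square_iff[symmetric]) (simp add: abs_le_iff)
    qed (use that in auto)
    then show ?thesis by auto
  qed
  ultimately show ?thesis
    using compact_Int_closed[of ?B ?C] by (simp only:)
qed

text \<open>A minimiser of the Rayleigh quotient on the unit sphere is an eigenvector, so its
  value is an eigenvalue.\<close>
lemma quad_form_ge_lambda_min:
  fixes A :: "real mat"
  assumes A: "A \<in> carrier_mat m m"
    and sym: "\<And>k l. k < m \<Longrightarrow> l < m \<Longrightarrow> A $$ (k, l) = A $$ (l, k)"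
  shows "lambda_min A * (\<Sum>k<m. (x k)\<^sup>2) \<le> quad_form A m x"
proof (cases "(\<Sum>k<m. (x k)\<^sup>2) = 0")
  case True
  then have "\<And>k. k < m \<Longrightarrow> x k = 0"
    by (subst (asm) sum_nonneg_eq_0_iff) auto
  then show ?thesis using True by (simp add: quad_form_def)
next
  case x_nz: False
  then have m: "m > 0" by (cases m) auto
  define K where "K = {x :: nat \<Rightarrow> real. (\<forall>i\<ge>m. x i = 0) \<and> (\<Sum>i<m. (x i)\<^sup>2) = 1}"
  have "(\<lambda>i. if i = 0 then 1 else 0) \<in> K"
    using m by (auto simp: K_def if_distrib[of "\<lambda>x. x\<^sup>2"] cong: if_cong)
  then have "K \<noteq> {}" by blast
  moreover have "continuous_on K (quad_form A m)"
    unfolding quad_form_def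
    by (intro continuous_intros continuous_on_subset[OF continuous_on_product_coordinates subset_UNIV])
  ultimately obtain v where v: "v \<in> K" and vmin: "\<And>y. y \<in> K \<Longrightarrow> quad_form A m v \<le> quad_form A m y"
    using continuous_attains_inf[OF compact_sphere[of m, folded K_def]] by blast
  define ev where "ev = quad_form A m v"
  \<comment> \<open>By homogeneity, minimality on the unit sphere extends to all vectors, after
    rescaling and padding with zeros.\<close>
  have ray: "ev * (\<Sum>k<m. (y k)\<^sup>2) \<le> quad_form A m y" for y
  proof (cases "(\<Sum>k<m. (y k)\<^sup>2) = 0")
    case True
    then have "\<And>k. k < m \<Longrightarrow> y k = 0"
      by (subst (asm) sum_nonneg_eq_0_iff) auto
    then show ?thesis using True by (simp add: quad_form_def)
  next
    case False
    define s where "s = (\<Sum>k<m. (y k)\<^sup>2)"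
    have s: "s > 0" unfolding s_def using False by (metis less_eq_real_def sum_nonneg zero_le_power2)
    define z where "z i = (if i < m then (1 / sqrt s) * y i else 0)" for i
    have "(\<Sum>i<m. (z i)\<^sup>2) = (\<Sum>i<m. (y i)\<^sup>2 / s)"
      using s by (intro sum.cong) (auto simp: z_def power_divide)
    also have "\<dots> = 1" using s by (simp add: sum_divide_distrib[symmetric] s_def[symmetric])
    finally have "ev \<le> quad_form A m z"
      unfolding ev_def by (intro vmin) (auto simp: K_def z_def)
    also have "quad_form A m z = quad_form A m (\<lambda>i. (1 / sqrt s) * y i)"
      unfolding quad_form_def z_def by (intro sum.cong) auto
    also have "\<dots> = quad_form A m y / s"
      unfolding quad_form_scale using s by (simp add: power_divide)
    finally show ?thesis using s by (simp add: field_simps s_def)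
  qed
  \<comment> \<open>First-order condition: if a coordinate of \<open>A v - ev v\<close> were
    nonzero, moving \<open>v\<close> along that coordinate would push the Rayleigh quotient below
    its minimum.\<close>
  have grad: "(\<Sum>l<m. A $$ (k, l) * v l) = ev * v k" if k: "k < m" for k
  proof (rule ccontr)
    assume ne: "\<not> ?thesis"
    define g where "g = (\<Sum>l<m. A $$ (k, l) * v l) - ev * v k"
    have g: "g \<noteq> 0" using ne by (simp add: g_def)
    define e where "e i = (if i = k then 1 else 0 :: real)" for i
    have sume: "(\<Sum>i<m. e i * F i) = F k" for F :: "nat \<Rightarrow> real"
      using k by (simp add: e_def if_distrib[of "\<lambda>x. x * _"] cong: if_cong)
    have e2: "(e i)\<^sup>2 = e i" for i by (simp add: e_def)
    define a where "a = quad_form A m e - ev"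
    have pos: "0 \<le> 2 * t * g + t\<^sup>2 * a" for t
    proof -
      have "ev * (\<Sum>i<m. (v i + t * e i)\<^sup>2) \<le> quad_form A m (\<lambda>i. v i + t * e i)"
        by (rule ray)
      moreover have "(\<Sum>i<m. (v i + t * e i)\<^sup>2) = (\<Sum>i<m. (v i)\<^sup>2) + 2 * t * (\<Sum>i<m. e i * v i) + t\<^sup>2 * (\<Sum>i<m. e i * 1)"
        unfolding sum_distrib_left sum.distrib[symmetric]
        by (intro sum.cong) (auto simp: power2_sum power_mult_distrib e2 mult_ac)
      moreover have "(\<Sum>i<m. (v i)\<^sup>2) = 1" using v by (simp add: K_def)
      moreover have "quad_form A m (\<lambda>i. v i + t * e i) = ev + 2 * t * (\<Sum>l<m. A $$ (k, l) * v l) + t\<^sup>2 * quad_form A m e"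
        by (subst quad_form_add) (auto simp: sym sume ev_def)
      ultimately show ?thesis
        unfolding sume
        by (simp add: ev_def[symmetric] g_def a_def algebra_simps)
    qed
    \<comment> \<open>The step length \<open>- g / (\<bar>a\<bar> + 1)\<close> is small enough for
      the linear term to beat the quadratic one, which makes the expression negative.\<close>
    have "0 \<le> 2 * (- g / (\<bar>a\<bar> + 1)) * g + (- g / (\<bar>a\<bar> + 1))\<^sup>2 * a" by (rule pos)
    also have "\<dots> = g\<^sup>2 / (\<bar>a\<bar> + 1) * (a / (\<bar>a\<bar> + 1) - 2)"
      by (simp add: power2_eq_square algebra_simps add_divide_distrib diff_divide_distrib)
    finally have "0 \<le> g\<^sup>2 / (\<bar>a\<bar> + 1) * (a / (\<bar>a\<bar> + 1) - 2)" .
    moreover have "g\<^sup>2 / (\<bar>a\<bar> + 1) > 0" using g by (simp add: divide_pos_pos add_nonneg_pos)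
    moreover have "a / (\<bar>a\<bar> + 1) < 2" by (subst pos_divide_less_eq) (auto simp: abs_if)
    ultimately show False
      using mult_pos_neg[of "g\<^sup>2 / (\<bar>a\<bar> + 1)" "a / (\<bar>a\<bar> + 1) - 2"] by linarith
  qed
  have "eigenvector A (vec m v) ev"
    unfolding eigenvector_def
  proof (intro conjI)
    show "vec m v \<in> carrier_vec (dim_row A)" using A by simp
    show "vec m v \<noteq> 0\<^sub>v (dim_row A)"
    proof
      assume eq: "vec m v = 0\<^sub>v (dim_row A)"
      have "v i = 0" if "i < m" for i
        using arg_cong[OF eq, of "\<lambda>u. vec_index u i"] that A by simp
      then show False using v by (simp add: K_def)
    qed
    show "A *\<^sub>v vec m v = ev \<cdot>\<^sub>v vec m v"
    proof (rule eq_vecI)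
      fix i assume "i < dim_vec (ev \<cdot>\<^sub>v vec m v)"
      then have i: "i < m" by simp
      then show "vec_index (A *\<^sub>v vec m v) i = vec_index (ev \<cdot>\<^sub>v vec m v) i"
        using A grad[OF i] by (simp add: scalar_prod_def lessThan_atLeast0)
    qed (use A in simp)
  qed
  then have "ev \<in> {k. eigenvalue A k}" by (auto simp: eigenvalue_def)
  \<comment> \<open>\<open>Min\<close> is meaningful only on a finite set; the eigenvalues are roots
    of the nonzero characteristic polynomial.\<close>
  moreover have "finite {k. eigenvalue A k}"
  proof -
    have "char_poly A \<noteq> 0" using degree_monic_char_poly[OF A] by auto
    then show ?thesis
      using poly_roots_finite[of "char_poly A"] eigenvalue_root_char_poly[OF A] by simp
  qed
  ultimately have "lambda_min A \<le> ev" unfolding lambda_min_def by (intro Min_le)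
  then have "lambda_min A * (\<Sum>k<m. (x k)\<^sup>2) \<le> ev * (\<Sum>k<m. (x k)\<^sup>2)"
    by (intro mult_right_mono sum_nonneg) auto
  also have "\<dots> \<le> quad_form A m x" by (rule ray)
  finally show ?thesis .
qed

section \<open>Positive definiteness and the sign of the determinant\<close>

lemma quad_form_scalar_prod:
  assumes "A \<in> carrier_mat m m" "v \<in> carrier_vec m"
  shows "quad_form A m (vec_index v) = v \<bullet> (A *\<^sub>v v)"
  using assms unfolding quad_form_def
  by (auto simp: scalar_prod_def lessThan_atLeast0 sum_distrib_left mult_ac intro!: sum.cong)

text \<open>A singular matrix has a nonzero kernel vector, at which the quadratic form
  vanishes.\<close>

lemma det_ne_0_if_pos_def:
  fixes A :: "real mat"
  assumes A: "A \<in> carrier_mat m m" and pos: "\<And>x. (\<Sum>k<m. (x k)\<^sup>2) > 0 \<Longrightarrow> quad_form A m x > 0"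
  shows "det A \<noteq> 0"
proof
  assume "det A = 0"
  then obtain v where v: "v \<in> carrier_vec m" "v \<noteq> 0\<^sub>v m" "A *\<^sub>v v = 0\<^sub>v m"
    using det_0_iff_vec_prod_zero[OF A] by auto
  have "(\<Sum>k<m. (vec_index v k)\<^sup>2) \<noteq> 0"
  proof
    assume "(\<Sum>k<m. (vec_index v k)\<^sup>2) = 0"
    then have "\<And>k. k < m \<Longrightarrow> vec_index v k = 0"
      by (subst (asm) sum_nonneg_eq_0_iff) auto
    then have "v = 0\<^sub>v m" using v(1) by (intro eq_vecI) auto
    then show False using v by simp
  qed
  then have "quad_form A m (vec_index v) > 0"
    by (intro pos) (metis less_eq_real_def sum_nonneg zero_le_power2)
  then show False
    using v by (simp add: quad_form_scalar_prod[OF A])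
qed

text \<open>The segment from the identity to \<open>A\<close> consists of positive definite matrices, except
  possibly for its endpoint \<open>A\<close>; so the determinant cannot change sign on it.\<close>
lemma det_nonneg_if_pos_semidef:
  fixes A :: "real mat"
  assumes A: "A \<in> carrier_mat m m" and pos: "\<And>x. quad_form A m x \<ge> 0"
  shows "det A \<ge> 0"
proof (rule ccontr)
  assume neg: "\<not> ?thesis"
  define B where "B s = mat m m (\<lambda>(k, l). s * A $$ (k, l) + (1 - s) * (if k = l then 1 else 0))" for s
  have B: "B s \<in> carrier_mat m m" for s by (simp add: B_def)
  have B1: "B 1 = A" using A by (auto simp: B_def)
  have "B 0 = 1\<^sub>m m" by (auto simp: B_def)
  then have det0: "det (B 0) = 1" by simp
  have "continuous_on {0..1} (\<lambda>s. det (B s))"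
  proof -
    have "det (B s) = (\<Sum>p | p permutes {0..<m}. of_int (sign p) *
        (\<Prod>i = 0..<m. s * A $$ (i, p i) + (1 - s) * (if i = p i then 1 else 0)))" for s
      unfolding det_def'[OF B]
    proof (intro sum.cong refl arg_cong2[of _ _ _ _ "(*)"] prod.cong)
      fix p i assume "p \<in> {p. p permutes {0..<m}}" "i \<in> {0..<m}"
      then have "i < m" "p i < m" using permutes_in_image[of p "{0..<m}" i] by auto
      then show "B s $$ (i, p i) = s * A $$ (i, p i) + (1 - s) * (if i = p i then 1 else 0)"
        by (simp add: B_def)
    qed
    then show ?thesis by (simp only:) (intro continuous_intros)
  qed
  moreover have "det (B 1) \<le> 0" "0 \<le> det (B 0)" using neg B1 det0 by auto
  ultimately obtain s where s: "0 \<le> s" "s \<le> 1" "det (B s) = 0"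
    using IVT2'[of "\<lambda>s. det (B s)" 1 0 0] by auto
  have "s \<noteq> 1" using neg B1 s by auto
  have q: "quad_form (B s) m x = s * quad_form A m x + (1 - s) * (\<Sum>k<m. (x k)\<^sup>2)" for x
  proof -
    have "quad_form (B s) m x = (\<Sum>k<m. \<Sum>l<m. s * (A $$ (k, l) * x k * x l) + (if k = l then (1 - s) * (x k)\<^sup>2 else 0))"
      unfolding quad_form_def
      by (intro sum.cong) (auto simp: B_def algebra_simps power2_eq_square)
    then show ?thesis
      by (simp add: quad_form_def sum.distrib sum_distrib_left)
  qed
  \<comment> \<open>As \<open>s < 1\<close>, the identity part contributes a strictly positive
    amount, so \<open>B s\<close> is positive definite.\<close>
  have "det (B s) \<noteq> 0"
    by (rule det_ne_0_if_pos_def[OF B], unfold q, rule add_nonneg_pos)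
       (use s \<open>s \<noteq> 1\<close> pos in auto)
  with s show False by simp
qed

subsection \<open>Weighted least squares\<close>

text \<open>The bilinear form polarising \<open>emp_norm2\<close>; it need not be definite, since a
  nonzero function may vanish at all sample points.\<close>

definition emp_inner :: "('a \<Rightarrow> real) \<Rightarrow> nat \<Rightarrow> (nat \<Rightarrow> 'a) \<Rightarrow> ('a \<Rightarrow> real) \<Rightarrow> ('a \<Rightarrow> real) \<Rightarrow> real" where
  "emp_inner w N xs f g = (1 / real N) * (\<Sum>i<N. (1 / w (xs i)) * f (xs i) * g (xs i))"

lemma emp_norm2_eq_inner: "emp_norm2 w N xs f = emp_inner w N xs f f"
  by (simp add: emp_norm2_def emp_inner_def power2_eq_square mult.assoc)

lemma emp_norm2_nonneg: "(\<And>x. w x \<ge> 0) \<Longrightarrow> emp_norm2 w N xs f \<ge> 0"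
  unfolding emp_norm2_def by (intro mult_nonneg_nonneg sum_nonneg) auto

lemma emp_inner_diff_left: "emp_inner w N xs (\<lambda>x. f x - g x) h = emp_inner w N xs f h - emp_inner w N xs g h"
  by (simp add: emp_inner_def left_diff_distrib right_diff_distrib diff_divide_distrib sum_subtractf)

lemma emp_inner_diff_right: "emp_inner w N xs h (\<lambda>x. f x - g x) = emp_inner w N xs h f - emp_inner w N xs h g"
  by (simp add: emp_inner_def left_diff_distrib right_diff_distrib diff_divide_distrib sum_subtractf)

lemma emp_inner_sum_left:
  "emp_inner w N xs (\<lambda>x. \<Sum>k<m. c k * \<phi> k x) h = (\<Sum>k<m. c k * emp_inner w N xs (\<phi> k) h)"
  unfolding emp_inner_def sum_distrib_left sum_distrib_right
  by (subst sum.swap) (simp add: mult_ac)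

lemma emp_inner_commute: "emp_inner w N xs f g = emp_inner w N xs g f"
  by (simp add: emp_inner_def mult_ac)

lemma emp_inner_sum_right:
  "emp_inner w N xs h (\<lambda>x. \<Sum>k<m. c k * \<phi> k x) = (\<Sum>k<m. c k * emp_inner w N xs h (\<phi> k))"
  by (simp add: emp_inner_commute[of w N xs h] emp_inner_sum_left)

lemma emp_norm2_add:
  "emp_norm2 w N xs (\<lambda>x. f x + g x) = emp_norm2 w N xs f + 2 * emp_inner w N xs g f + emp_norm2 w N xs g"
  unfolding emp_norm2_def emp_inner_def
  by (simp add: power2_sum sum.distrib sum_distrib_left algebra_simps add_divide_distrib diff_divide_distrib)

lemma emp_norm2_diff:
  "emp_norm2 w N xs (\<lambda>x. f x - g x) = emp_norm2 w N xs f - 2 * emp_inner w N xs g f + emp_norm2 w N xs g"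
  unfolding emp_norm2_def emp_inner_def
  by (simp add: power2_diff sum.distrib sum_subtractf sum_distrib_left algebra_simps add_divide_distrib diff_divide_distrib)

section \<open>The Gram matrix of the empirical inner product\<close>

lemma Gram_carrier: "Gram \<phi> m w N xs \<in> carrier_mat m m"
  by (simp add: Gram_def PhiTPhi_def)

lemma Gram_index:
  "k < m \<Longrightarrow> l < m \<Longrightarrow> Gram \<phi> m w N xs $$ (k, l) = emp_inner w N xs (\<phi> k) (\<phi> l)"
  by (simp add: Gram_def PhiTPhi_def emp_inner_def)

lemma Gram_sym:
  "k < m \<Longrightarrow> l < m \<Longrightarrow> Gram \<phi> m w N xs $$ (k, l) = Gram \<phi> m w N xs $$ (l, k)"
  by (simp add: Gram_index emp_inner_commute)

text \<open>Through this identity a lower bound on the smallest eigenvalue bounds the empirical norm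
  on \<open>Vm\<close> from below by the norm of the coefficients.\<close>

lemma quad_form_Gram:
  "quad_form (Gram \<phi> m w N xs) m c = emp_norm2 w N xs (\<lambda>x. \<Sum>k<m. c k * \<phi> k x)"
  unfolding quad_form_def emp_norm2_eq_inner emp_inner_sum_left
  by (intro sum.cong refl) (simp add: emp_inner_sum_right Gram_index sum_distrib_left mult_ac)

text \<open>A positive smallest eigenvalue makes the Gram matrix invertible: the normal equations
  are solvable and the minimiser is unique, so the definite description in \<open>wls\<close>
  denotes it.\<close>

lemma wls_normal_equations:
  assumes w: "\<And>x. w x \<ge> 0"
    and lmin: "lambda_min (Gram \<phi> m w N xs) > 0"
  shows "\<exists>c. wls \<phi> m w N xs f = (\<lambda>x. \<Sum>k<m. c k * \<phi> k x) \<and>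
    (\<forall>k<m. emp_inner w N xs (\<phi> k) (\<lambda>x. f x - (\<Sum>l<m. c l * \<phi> l x)) = 0)"
proof -
  let ?G = "Gram \<phi> m w N xs"
  have coercive: "lambda_min ?G * (\<Sum>k<m. (x k)\<^sup>2) \<le> quad_form ?G m x" for x
    by (rule quad_form_ge_lambda_min[OF Gram_carrier Gram_sym])
  have pos: "quad_form ?G m x > 0" if "(\<Sum>k<m. (x k)\<^sup>2) > 0" for x
    using coercive[of x] mult_pos_pos[OF lmin that] by linarith
  have "det ?G \<noteq> 0"
    by (rule det_ne_0_if_pos_def[OF Gram_carrier pos])
  then obtain B where B: "B \<in> carrier_mat m m" "?G * B = 1\<^sub>m m"
    using det_non_zero_imp_unit[OF Gram_carrier \<open>det ?G \<noteq> 0\<close>] by (auto simp: Units_def ring_mat_def)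
  define b where "b = vec m (\<lambda>k. emp_inner w N xs (\<phi> k) f)"
  define c where "c = vec_index (B *\<^sub>v b)"
  have "?G *\<^sub>v (B *\<^sub>v b) = b"
    using assoc_mult_mat_vec[OF Gram_carrier[of \<phi> m w N xs] B(1), of b] B by (simp add: b_def)
  then have Gc: "(\<Sum>l<m. c l * emp_inner w N xs (\<phi> k) (\<phi> l)) = emp_inner w N xs (\<phi> k) f" if "k < m" for k
  proof -
    have "vec_index (?G *\<^sub>v (B *\<^sub>v b)) k = (\<Sum>l<m. ?G $$ (k, l) * c l)"
      using that Gram_carrier[of \<phi> m w N xs] B
      by (simp add: scalar_prod_def c_def lessThan_atLeast0)
    also have "\<dots> = (\<Sum>l<m. c l * emp_inner w N xs (\<phi> k) (\<phi> l))"
      using that by (intro sum.cong) (auto simp: Gram_index)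
    finally show ?thesis
      using \<open>?G *\<^sub>v (B *\<^sub>v b) = b\<close> that by (simp add: b_def)
  qed
  define g where "g = (\<lambda>x. \<Sum>k<m. c k * \<phi> k x)"
  have normal: "emp_inner w N xs (\<phi> k) (\<lambda>x. f x - g x) = 0" if "k < m" for k
    using Gc[OF that]
    by (subst emp_inner_commute, simp only: emp_inner_diff_left g_def emp_inner_sum_left)
       (simp add: emp_inner_commute)
  \<comment> \<open>Empirical Pythagoras: the residual \<open>f - g\<close> is orthogonal to
    \<open>Vm\<close>, so every competitor pays the quadratic form of its coefficient
    difference.\<close>
  have pyth: "emp_norm2 w N xs (\<lambda>x. f x - (\<Sum>k<m. d k * \<phi> k x)) =
      emp_norm2 w N xs (\<lambda>x. f x - g x) + quad_form ?G m (\<lambda>k. c k - d k)" for d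
  proof -
    define e where "e = (\<lambda>x. \<Sum>k<m. (c k - d k) * \<phi> k x)"
    have eq: "(\<lambda>x. f x - (\<Sum>k<m. d k * \<phi> k x)) = (\<lambda>x. (f x - g x) + e x)"
      by (auto simp: g_def e_def algebra_simps sum_subtractf)
    have orth: "emp_inner w N xs e (\<lambda>x. f x - g x) = 0"
      unfolding e_def emp_inner_sum_left by (simp add: normal)
    show ?thesis
      unfolding eq emp_norm2_add orth by (simp add: quad_form_Gram e_def)
  qed
  have "wls \<phi> m w N xs f = g"
    unfolding wls_def
  proof (rule the_equality, intro conjI ballI)
    show "g \<in> Vm \<phi> m" by (auto simp: Vm_def g_def)
    fix h assume "h \<in> Vm \<phi> m"
    then obtain d where d: "h = (\<lambda>x. \<Sum>k<m. d k * \<phi> k x)" by (auto simp: Vm_def)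
    show "emp_norm2 w N xs (\<lambda>x. f x - g x) \<le> emp_norm2 w N xs (\<lambda>x. f x - h x)"
      unfolding d pyth quad_form_Gram using emp_norm2_nonneg[OF w] by simp
  next
    fix h assume h: "h \<in> Vm \<phi> m \<and>
      (\<forall>h'\<in>Vm \<phi> m. emp_norm2 w N xs (\<lambda>x. f x - h x) \<le> emp_norm2 w N xs (\<lambda>x. f x - h' x))"
    then obtain d where d: "h = (\<lambda>x. \<Sum>k<m. d k * \<phi> k x)" by (auto simp: Vm_def)
    have "emp_norm2 w N xs (\<lambda>x. f x - h x) \<le> emp_norm2 w N xs (\<lambda>x. f x - g x)"
      using h by (auto simp: Vm_def g_def)
    \<comment> \<open>A second minimiser makes the form of the difference nonpositive; definiteness
      then identifies the coefficients.\<close>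
    then have "quad_form ?G m (\<lambda>k. c k - d k) \<le> 0"
      unfolding d pyth by simp
    then have "\<not> (\<Sum>k<m. (c k - d k)\<^sup>2) > 0" using pos[of "\<lambda>k. c k - d k"] by force
    moreover have "(\<Sum>k<m. (c k - d k)\<^sup>2) \<ge> 0" by (simp add: sum_nonneg)
    ultimately have "(\<Sum>k<m. (c k - d k)\<^sup>2) = 0" by linarith
    then have "\<And>k. k < m \<Longrightarrow> c k = d k"
      by (subst (asm) sum_nonneg_eq_0_iff) auto
    then show "h = g" by (auto simp: d g_def)
  qed
  with normal show ?thesis by (auto simp: g_def)
qed

text \<open>The estimator is a projection onto \<open>Vm \<phi> m\<close>, so \<open>wls f - p\<close> is the estimate of the
  residual \<open>f - p\<close>.\<close>
lemma wls_error_bounds: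
  assumes w: "\<And>x. w x \<ge> 0"
    and lmin: "lambda_min (Gram \<phi> m w N xs) \<ge> \<epsilon>" and \<epsilon>: "\<epsilon> > 0"
    and h: "\<And>x. h x = f x - (\<Sum>k<m. p k * \<phi> k x)"
  obtains c where "wls \<phi> m w N xs f = (\<lambda>x. \<Sum>k<m. c k * \<phi> k x)"
    and "(\<Sum>k<m. (c k - p k)\<^sup>2) \<le> (1 / \<epsilon>) * emp_norm2 w N xs h"
    and "(\<Sum>k<m. (c k - p k)\<^sup>2) \<le> (1 / \<epsilon>)\<^sup>2 * (\<Sum>k<m. (emp_inner w N xs (\<phi> k) h)\<^sup>2)"
proof -
  let ?G = "Gram \<phi> m w N xs"
  have lmin_pos: "lambda_min ?G > 0" using lmin \<epsilon> by linarith
  obtain c where c: "wls \<phi> m w N xs f = (\<lambda>x. \<Sum>k<m. c k * \<phi> k x)"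
    and normal: "\<And>k. k < m \<Longrightarrow> emp_inner w N xs (\<phi> k) (\<lambda>x. f x - (\<Sum>l<m. c l * \<phi> l x)) = 0"
    using wls_normal_equations[OF w lmin_pos, where f = f] by blast
  define d where "d k = c k - p k" for k
  define e where "e = (\<lambda>x. \<Sum>k<m. d k * \<phi> k x)"
  define s where "s = (\<Sum>k<m. (d k)\<^sup>2)"
  define b where "b k = emp_inner w N xs (\<phi> k) h" for k
  have s0: "s \<ge> 0" by (simp add: s_def sum_nonneg)
  have "\<epsilon> * s \<le> lambda_min ?G * s" using lmin s0 by (intro mult_right_mono)
  also have "\<dots> \<le> quad_form ?G m d"
    unfolding s_def by (rule quad_form_ge_lambda_min[OF Gram_carrier Gram_sym])
  also have "\<dots> = emp_norm2 w N xs e" unfolding quad_form_Gram e_def ..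
  finally have coercive: "\<epsilon> * s \<le> emp_norm2 w N xs e" .
  have res: "(\<lambda>x. f x - (\<Sum>l<m. c l * \<phi> l x)) = (\<lambda>x. h x - e x)"
    by (auto simp: h e_def d_def algebra_simps sum_subtractf)
  \<comment> \<open>\<open>e\<close> is the empirical projection of \<open>h\<close>: the difference
    \<open>h - e\<close> is orthogonal to it, hence its norm is at most that of
    \<open>h\<close>.\<close>
  have "emp_inner w N xs e (\<lambda>x. h x - e x) = 0"
    unfolding e_def emp_inner_sum_left using normal unfolding res e_def by simp
  then have eh: "emp_inner w N xs e h = emp_norm2 w N xs e"
    by (simp add: emp_norm2_eq_inner emp_inner_diff_right)
  have "0 \<le> emp_norm2 w N xs (\<lambda>x. h x - e x)" by (rule emp_norm2_nonneg[OF w])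
  also have "\<dots> = emp_norm2 w N xs h - 2 * emp_inner w N xs e h + emp_norm2 w N xs e"
    by (rule emp_norm2_diff)
  finally have "emp_norm2 w N xs e \<le> emp_norm2 w N xs h" using eh by simp
  with coercive have "s \<le> (1 / \<epsilon>) * emp_norm2 w N xs h"
    using \<epsilon> by (simp add: field_simps)
  \<comment> \<open>Cauchy-Schwarz on the coefficients: after squaring, a spare factor
    \<open>s\<close> has to be cancelled, hence the separate case \<open>s = 0\<close>.\<close>
  moreover have "s \<le> (1 / \<epsilon>)\<^sup>2 * (\<Sum>k<m. (b k)\<^sup>2)"
  proof (cases "s = 0")
    case False
    then have s: "s > 0" using s0 by simp
    have "\<epsilon> * s \<le> (\<Sum>k<m. d k * b k)"
      using coercive unfolding eh[symmetric] unfolding e_def emp_inner_sum_left b_def .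
    then have "(\<epsilon> * s)\<^sup>2 \<le> (\<Sum>k<m. d k * b k)\<^sup>2"
      using \<epsilon> s by (intro power_mono) auto
    also have "\<dots> \<le> s * (\<Sum>k<m. (b k)\<^sup>2)"
      unfolding s_def by (rule Cauchy_Schwarz_ineq_sum)
    finally have "s * (\<epsilon>\<^sup>2 * s) \<le> s * (\<Sum>k<m. (b k)\<^sup>2)"
      by (simp add: power_mult_distrib power2_eq_square mult_ac)
    then have "\<epsilon>\<^sup>2 * s \<le> (\<Sum>k<m. (b k)\<^sup>2)" using s by simp
    then show ?thesis using \<epsilon> by (simp add: field_simps power_divide)
  qed (simp add: sum_nonneg)
  ultimately show thesis
    using c by (intro that[of c]) (auto simp: s_def d_def b_def)
qed

subsection \<open>Determinants of sums of rank-one matrices\<close>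

definition injections :: "nat \<Rightarrow> nat \<Rightarrow> (nat \<Rightarrow> nat) set" where
  "injections m N = {\<iota> \<in> {..<m} \<rightarrow>\<^sub>E {..<N}. inj_on \<iota> {..<m}}"

lemma finite_injections [simp]: "finite (injections m N)"
  unfolding injections_def by (rule finite_subset[of _ "{..<m} \<rightarrow>\<^sub>E {..<N}"]) (auto intro: finite_PiE)

lemma injectionsD:
  assumes "\<iota> \<in> injections m N"
  shows "inj_on \<iota> {..<m}" "\<And>k. k < m \<Longrightarrow> \<iota> k < N" "\<iota> ` {..<m} \<subseteq> {..<N}"
  using assms by (auto simp: injections_def PiE_iff)

text \<open>This is the reciprocal of the normalising constant of \<open>gamma_vs\<close>;
  expectations under that measure thereby become averages over injections.\<close>

lemma card_injections:
  assumes "m \<le> N"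
  shows "real (card (injections m N)) = fact N / fact (N - m)"
proof -
  have "card (injections m N) = (\<Prod>i = 0..<m. N - i)"
    using card_inj_on_subset_funcset[of "{..<m}" "{..<N}" "{..<m}"] by (simp add: injections_def)
  also have "\<dots> * fact (N - m) = (fact N :: nat)"
    using assms
  proof (induction m)
    case (Suc m)
    have "fact (N - m) = (N - m) * (fact (N - Suc m) :: nat)"
      using Suc.prems by (metis Suc_diff_Suc Suc_le_lessD fact_Suc of_nat_id)
    then show ?case using Suc by (simp add: mult_ac)
  qed simp
  finally have "real (card (injections m N) * fact (N - m)) = real (fact N)"
    by simp
  then show ?thesis by (simp add: field_simps)
qed

text \<open>A map \<open>\<iota>\<close> that is not injective contributes the determinant of a matrix with two equal rows.\<close>
lemma det_sum_rank_one:
  fixes v u :: "nat \<Rightarrow> nat \<Rightarrow> 'a :: comm_ring_1"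
  shows "det (mat m m (\<lambda>(k, l). \<Sum>i<N. v i k * u i l)) =
    (\<Sum>\<iota>\<in>injections m N. \<Sum>p | p permutes {..<m}. of_int (sign p) * (\<Prod>k<m. v (\<iota> k) k * u (\<iota> k) (p k)))"
proof -
  let ?D = "\<lambda>\<iota>. \<Sum>p | p permutes {..<m}. of_int (sign p) * (\<Prod>k<m. v (\<iota> k) k * u (\<iota> k) (p k))"
  have "det (mat m m (\<lambda>(k, l). \<Sum>i<N. v i k * u i l)) =
      (\<Sum>p | p permutes {..<m}. of_int (sign p) * (\<Prod>k<m. \<Sum>i<N. v i k * u i (p k)))"
    unfolding det_def'[OF mat_carrier] lessThan_atLeast0[symmetric]
  proof (intro sum.cong refl arg_cong2[of _ _ _ _ "(*)"] prod.cong)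
    fix p k assume "p \<in> {p. p permutes {..<m}}" "k \<in> {..<m}"
    then have "k < m" "p k < m" using permutes_in_image[of p "{..<m}" k] by auto
    then show "mat m m (\<lambda>(k, l). \<Sum>i<N. v i k * u i l) $$ (k, p k) = (\<Sum>i<N. v i k * u i (p k))"
      by simp
  qed
  \<comment> \<open>Multiplying out the rows: a map \<open>\<iota>\<close> selects the summand
    \<open>\<iota> k\<close> in row \<open>k\<close>.\<close>
  also have "\<dots> = (\<Sum>p | p permutes {..<m}. \<Sum>\<iota>\<in>{..<m} \<rightarrow>\<^sub>E {..<N}.
      of_int (sign p) * (\<Prod>k<m. v (\<iota> k) k * u (\<iota> k) (p k)))"
    by (subst prod_sum_PiE) (simp_all add: sum_distrib_left)
  also have "\<dots> = (\<Sum>\<iota>\<in>{..<m} \<rightarrow>\<^sub>E {..<N}. ?D \<iota>)"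
    by (rule sum.swap)
  also have "\<dots> = (\<Sum>\<iota>\<in>injections m N. ?D \<iota>)"
  proof (rule sum.mono_neutral_right)
    show "\<forall>\<iota>\<in>({..<m} \<rightarrow>\<^sub>E {..<N}) - injections m N. ?D \<iota> = 0"
    proof
      fix \<iota> assume "\<iota> \<in> ({..<m} \<rightarrow>\<^sub>E {..<N}) - injections m N"
      then obtain a b where ab: "a < m" "b < m" "a \<noteq> b" "\<iota> a = \<iota> b"
        by (auto simp: injections_def inj_on_def)
      let ?U = "mat m m (\<lambda>(k, l). u (\<iota> k) l)"
      have "det ?U = 0"
        using ab by (intro det_identical_rows[of ?U m a b]) (auto intro!: eq_vecI)
      moreover have "det ?U = (\<Sum>p | p permutes {..<m}. of_int (sign p) * (\<Prod>k<m. u (\<iota> k) (p k)))"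
        unfolding det_def'[OF mat_carrier] lessThan_atLeast0[symmetric]
      proof (intro sum.cong refl arg_cong2[of _ _ _ _ "(*)"] prod.cong)
        fix p k assume "p \<in> {p. p permutes {..<m}}" "k \<in> {..<m}"
        then have "k < m" "p k < m" using permutes_in_image[of p "{..<m}" k] by auto
        then show "?U $$ (k, p k) = u (\<iota> k) (p k)" by simp
      qed
      \<comment> \<open>The factors \<open>v\<close> do not involve \<open>p\<close> and come out,
        leaving the determinant of the selected rows.\<close>
      moreover have "?D \<iota> = (\<Prod>k<m. v (\<iota> k) k) * (\<Sum>p | p permutes {..<m}. of_int (sign p) * (\<Prod>k<m. u (\<iota> k) (p k)))"
        by (simp add: sum_distrib_left prod.distrib mult_ac)
      ultimately show "?D \<iota> = 0" by simp
    qed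
  qed (auto simp: injections_def intro: finite_PiE)
  finally show ?thesis .
qed

section \<open>Matrices that differ from the identity in at most two rows\<close>

lemma permutes_fixing_all_but_two:
  assumes p: "p permutes A" and fixed: "\<And>k. k \<in> A - {a, b} \<Longrightarrow> p k = k"
  shows "p = id \<or> p = Transposition.transpose a b"
proof -
  have *: "p k = k" if "k \<noteq> a" "k \<noteq> b" for k
    using fixed that permutes_not_in[OF p] by (cases "k \<in> A") auto
  have inj: "p x = p y \<Longrightarrow> x = y" for x y
    using permutes_inj[OF p] by (auto dest: injD)
  have ab: "p a \<in> {a, b}" "p b \<in> {a, b}"
    using *[of "p a"] *[of "p b"] inj[of "p a" a] inj[of "p b" b] by auto
  show ?thesis
  proof (cases "p a = a")
    case True
    then have "p b = b" using ab(2) inj[of a b] by auto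
    have "p x = x" for x
      using *[of x] \<open>p b = b\<close> True by (cases "x = a"; cases "x = b") auto
    then have "p = id" by (auto simp: fun_eq_iff)
    then show ?thesis ..
  next
    case False
    then have "p a = b" using ab by simp
    moreover then have "p b = a" using ab(2) inj[of a b] False by auto
    ultimately have "p x = Transposition.transpose a b x" for x
      using *[of x] by (cases "x = a"; cases "x = b") (auto simp: Transposition.transpose_def)
    then have "p = Transposition.transpose a b" by (simp add: fun_eq_iff)
    then show ?thesis ..
  qed
qed

text \<open>A Leibniz determinant: a permutation moving an index other than \<open>a\<close> and
  \<open>b\<close> meets a zero, so only the identity and the transposition remain and give a two by
  two minor. Allowing \<open>a = b\<close> covers a single modified row.\<close>

lemma sum_permutations_identity_but_two_rows:
  fixes B :: "nat \<Rightarrow> nat \<Rightarrow> 'a :: comm_ring_1"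
  assumes a: "a < m" and b: "b < m"
    and B: "\<And>k l. k < m \<Longrightarrow> l < m \<Longrightarrow> k \<noteq> a \<Longrightarrow> k \<noteq> b \<Longrightarrow> B k l = (if k = l then 1 else 0)"
  shows "(\<Sum>p | p permutes {..<m}. of_int (sign p) * (\<Prod>k<m. B k (p k))) =
    (if a = b then B a a else B a a * B b b - B a b * B b a)"
proof -
  let ?F = "\<lambda>p. of_int (sign p) * (\<Prod>k<m. B k (p k))"
  have perm: "id permutes {..<m}" "Transposition.transpose a b permutes {..<m}"
    using a b by (auto intro: permutes_id permutes_swap_id)
  have "sum ?F {p. p permutes {..<m}} = sum ?F {id, Transposition.transpose a b}"
  proof (rule sum.mono_neutral_right)
    show "\<forall>p\<in>{p. p permutes {..<m}} - {id, Transposition.transpose a b}. ?F p = 0"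
    proof
      fix p assume p: "p \<in> {p. p permutes {..<m}} - {id, Transposition.transpose a b}"
      then obtain k where k: "k < m" "k \<noteq> a" "k \<noteq> b" "p k \<noteq> k"
        using permutes_fixing_all_but_two[of p "{..<m}" a b] by auto
      have "p k < m" using p k permutes_in_image[of p "{..<m}" k] by auto
      then have "B k (p k) = 0" using k B[of k "p k"] by auto
      then have "(\<Prod>k<m. B k (p k)) = 0" using k by (intro prod_zero) auto
      then show "?F p = 0" by simp
    qed
  qed (use perm in \<open>auto intro: finite_permutations\<close>)
  also have "\<dots> = (if a = b then B a a else B a a * B b b - B a b * B b a)"
  proof (cases "a = b")
    case True
    have "(\<Prod>k<m. B k k) = B a a * (\<Prod>k\<in>{..<m} - {a}. B k k)"
      using a by (intro prod.remove) auto
    also have "(\<Prod>k\<in>{..<m} - {a}. B k k) = 1"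
      using True B by (intro prod.neutral) auto
    finally show ?thesis using True by simp
  next
    case False
    have rm: "(\<Prod>k<m. F k) = F a * F b * (\<Prod>k\<in>{..<m} - {a} - {b}. F k)" for F :: "nat \<Rightarrow> 'a"
      using a b False by (simp add: prod.remove[of "{..<m}" a] prod.remove[of "{..<m} - {a}" b] mult_ac)
    have 1: "(\<Prod>k\<in>{..<m} - {a} - {b}. B k k) = 1"
      using B by (intro prod.neutral) auto
    have 2: "(\<Prod>k\<in>{..<m} - {a} - {b}. B k (Transposition.transpose a b k)) = 1"
      using B by (intro prod.neutral) (auto simp: Transposition.transpose_def)
    have "Transposition.transpose a b \<noteq> id" using False by (metis id_apply transpose_apply_first)
    then show ?thesis
      using False rm[of "\<lambda>k. B k k"] rm[of "\<lambda>k. B k (Transposition.transpose a b k)"] 1 2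
      by (simp add: sign_swap_id)
  qed
  finally show ?thesis .
qed

subsection \<open>Moments of linear and quadratic statistics of a block\<close>

lemma PhiTPhi_carrier: "PhiTPhi \<phi> m w N xs \<in> carrier_mat m m"
  by (simp add: PhiTPhi_def)

text \<open>Since \<open>ennreal\<close> cuts off negative values, the density of
  \<open>gamma_vs\<close> is the scaled determinant only thanks to this sign. The quadratic form is
  a weighted sum of squares.\<close>

lemma det_PhiTPhi_nonneg:
  assumes "\<And>x. w x \<ge> 0"
  shows "det (PhiTPhi \<phi> m w N xs) \<ge> 0"
proof (rule det_nonneg_if_pos_semidef[OF PhiTPhi_carrier])
  fix x
  have "quad_form (PhiTPhi \<phi> m w N xs) m x = (\<Sum>i<N. \<Sum>k<m. \<Sum>l<m. (1 / w (xs i)) * (x k * \<phi> k (xs i)) * (x l * \<phi> l (xs i)))"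
  proof -
    have "quad_form (PhiTPhi \<phi> m w N xs) m x = (\<Sum>k<m. \<Sum>l<m. \<Sum>i<N. (1 / w (xs i)) * (x k * \<phi> k (xs i)) * (x l * \<phi> l (xs i)))"
      unfolding quad_form_def by (intro sum.cong) (auto simp: PhiTPhi_def sum_distrib_left sum_distrib_right mult_ac)
    also have "\<dots> = (\<Sum>k<m. \<Sum>i<N. \<Sum>l<m. (1 / w (xs i)) * (x k * \<phi> k (xs i)) * (x l * \<phi> l (xs i)))"
      by (intro sum.cong refl sum.swap)
    also have "\<dots> = (\<Sum>i<N. \<Sum>k<m. \<Sum>l<m. (1 / w (xs i)) * (x k * \<phi> k (xs i)) * (x l * \<phi> l (xs i)))"
      by (rule sum.swap)
    finally show ?thesis .
  qed
  also have "\<dots> = (\<Sum>i<N. (1 / w (xs i)) * (\<Sum>k<m. x k * \<phi> k (xs i))\<^sup>2)"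
    by (simp add: power2_eq_square sum_product sum_distrib_left mult_ac)
  also have "\<dots> \<ge> 0" using assms by (intro sum_nonneg mult_nonneg_nonneg) auto
  finally show "quad_form (PhiTPhi \<phi> m w N xs) m x \<ge> 0" .
qed

section \<open>Orthonormal basis and sampling weight\<close>

locale weighted_onb =
  fixes M :: "'a measure" and \<phi> :: "nat \<Rightarrow> 'a \<Rightarrow> real" and w :: "'a \<Rightarrow> real" and m :: nat and \<alpha> :: real
  assumes prob_M: "prob_space M"
    and m_pos: "m > 0"
    and \<phi>_meas [measurable]: "\<And>i. i < m \<Longrightarrow> \<phi> i \<in> borel_measurable M"
    and \<phi>_L2: "\<And>i. i < m \<Longrightarrow> integrable M (\<lambda>x. (\<phi> i x)\<^sup>2)"
    and \<phi>_orth: "\<And>i j. i < m \<Longrightarrow> j < m \<Longrightarrow> (\<integral>x. \<phi> i x * \<phi> j x \<partial>M) = (if i = j then 1 else 0)"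
    and w_meas [measurable]: "w \<in> borel_measurable M"
    and w_nonneg: "\<And>x. w x \<ge> 0"
    and w_int: "integrable M w" and w_one: "(\<integral>x. w x \<partial>M) = 1"
    and \<alpha>_pos: "0 < \<alpha>"
    and w_ge: "\<And>x. w x \<ge> \<alpha> * wm \<phi> m x"
begin

text \<open>\<open>w_ge\<close> solved for the basis functions: a multiple of \<open>w\<close>
  dominates their squares, which makes the integrals with a factor \<open>1 / w\<close>
  finite.\<close>

lemma sum_phi_sq_le: "(\<Sum>k<m. (\<phi> k x)\<^sup>2) \<le> real m / \<alpha> * w x"
  using w_ge[of x] m_pos \<alpha>_pos by (simp add: wm_def field_simps)

lemma phi_sq_le: "k < m \<Longrightarrow> (\<phi> k x)\<^sup>2 \<le> real m / \<alpha> * w x"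
  by (rule order.trans[OF _ sum_phi_sq_le]) (auto intro!: member_le_sum)

lemma phi_prod_le:
  assumes "k < m" "l < m"
  shows "\<bar>\<phi> k x * \<phi> l x\<bar> \<le> real m / \<alpha> * w x"
proof -
  have "0 \<le> (\<bar>\<phi> k x\<bar> - \<bar>\<phi> l x\<bar>)\<^sup>2" by simp
  then have "2 * \<bar>\<phi> k x * \<phi> l x\<bar> \<le> (\<phi> k x)\<^sup>2 + (\<phi> l x)\<^sup>2"
    by (simp add: power2_diff abs_mult)
  moreover have "2 * t \<le> a + b \<Longrightarrow> a \<le> C \<Longrightarrow> b \<le> C \<Longrightarrow> t \<le> C" for t a b C :: real
    by linarith
  ultimately show ?thesis
    using phi_sq_le[OF assms(1), of x] phi_sq_le[OF assms(2), of x] by blast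
qed

text \<open>Where \<open>w\<close> vanishes, \<open>1 / w\<close> is 0 by convention; the basis
  functions vanish there too, so cancelling \<open>w\<close> against \<open>1 / w\<close> stays
  valid.\<close>

lemma phi_eq_0: "k < m \<Longrightarrow> w x = 0 \<Longrightarrow> \<phi> k x = 0"
  using phi_sq_le[of k x] by simp

lemma integrable_phi_prod:
  assumes "k < m" "l < m"
  shows "integrable M (\<lambda>x. \<phi> k x * \<phi> l x)"
proof (rule Bochner_Integration.integrable_bound)
  show "integrable M (\<lambda>x. real m / \<alpha> * w x)" using w_int by simp
  show "AE x in M. norm (\<phi> k x * \<phi> l x) \<le> norm (real m / \<alpha> * w x)"
    unfolding real_norm_def by (intro AE_I2 order.trans[OF phi_prod_le[OF assms] abs_ge_self])
qed (use assms in measurable)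

abbreviation "\<nu> \<equiv> density M w"

lemma prob_nu: "prob_space \<nu>"
proof (rule prob_spaceI)
  have "emeasure \<nu> (space \<nu>) = (\<integral>\<^sup>+ x. ennreal (w x) \<partial>M)"
    by (simp add: emeasure_density cong: nn_integral_cong)
  also have "\<dots> = 1" using nn_integral_eq_integral[OF w_int] w_nonneg w_one by simp
  finally show "emeasure \<nu> (space \<nu>) = 1" .
qed

definition mean :: "('a \<Rightarrow> real) \<Rightarrow> real" where
  "mean u = (\<integral>x. w x * u x \<partial>M)"

text \<open>The \<open>\<nu>\<close>-expectation of \<open>u * \<phi> k * \<phi> l / w\<close> with
  the weight already cancelled: the entry that a selected point contributes to the expanded
  determinant.\<close>

definition moment :: "('a \<Rightarrow> real) \<Rightarrow> nat \<Rightarrow> nat \<Rightarrow> real" where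
  "moment u k l = (\<integral>x. u x * (\<phi> k x * \<phi> l x) \<partial>M)"

text \<open>The integrability that the single-point factors of the expanded determinant
  require.\<close>

definition admissible :: "('a \<Rightarrow> real) \<Rightarrow> bool" where
  "admissible u \<longleftrightarrow> u \<in> borel_measurable M \<and> integrable M (\<lambda>x. w x * u x) \<and>
    (\<forall>k<m. \<forall>l<m. integrable M (\<lambda>x. u x * (\<phi> k x * \<phi> l x)))"

lemma admissible_one: "admissible (\<lambda>_. 1)"
  using w_int integrable_phi_prod by (simp add: admissible_def)

lemma mean_one: "mean (\<lambda>_. 1) = 1"
  by (simp add: mean_def w_one)

lemma moment_one: "k < m \<Longrightarrow> l < m \<Longrightarrow> moment (\<lambda>_. 1) k l = (if k = l then 1 else 0)"
  by (simp add: moment_def \<phi>_orth)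

lemma moment_commute: "moment u k l = moment u l k"
  by (simp add: moment_def mult_ac)

lemma integral_nu:
  assumes "f \<in> borel_measurable M"
  shows "integral\<^sup>L \<nu> f = (\<integral>x. w x * f x \<partial>M)"
    and "integrable \<nu> f \<longleftrightarrow> integrable M (\<lambda>x. w x * f x)"
  using assms w_nonneg by (simp_all add: integral_density integrable_density)

text \<open>Each term of the expanded determinant is a product of functions of one point each, so
  Fubini applies: points in the range of \<open>\<iota>\<close> yield moments, the others
  means.\<close>

lemma integral_det_prod:
  assumes g: "\<And>i. i < N \<Longrightarrow> admissible (g i)"
  defines "F \<equiv> \<lambda>xs. det (PhiTPhi \<phi> m w N xs) * (\<Prod>i<N. g i (xs i))"
  shows "integrable (PiM {..<N} (\<lambda>_. \<nu>)) F"
    and "integral\<^sup>L (PiM {..<N} (\<lambda>_. \<nu>)) F =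
      (\<Sum>\<iota>\<in>injections m N. (\<Sum>p | p permutes {..<m}. of_int (sign p) * (\<Prod>k<m. moment (g (\<iota> k)) k (p k))) *
        (\<Prod>i\<in>{..<N} - \<iota> ` {..<m}. mean (g i)))"
proof -
  interpret nu: prob_space \<nu> by (rule prob_nu)
  interpret Q: product_sigma_finite "\<lambda>_::nat. \<nu>" ..
  \<comment> \<open>The factor at point \<open>i\<close>; \<open>inv_into\<close> recovers the row
    \<open>k\<close> with \<open>\<iota> k = i\<close>.\<close>
  define G where "G \<iota> p i x =
    (if i \<in> \<iota> ` {..<m} then g i x * (1 / w x * \<phi> (inv_into {..<m} \<iota> i) x * \<phi> (p (inv_into {..<m} \<iota> i)) x) else g i x)"
    for \<iota> p :: "nat \<Rightarrow> nat" and i x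
  have split: "(\<Prod>i<N. c i) = (\<Prod>k<m. c (\<iota> k)) * (\<Prod>i\<in>{..<N} - \<iota> ` {..<m}. c i)"
    if "\<iota> \<in> injections m N" for c :: "nat \<Rightarrow> real" and \<iota>
    using injectionsD[OF that] by (subst prod.subset_diff[of "\<iota> ` {..<m}"]) (auto simp: prod.reindex)
  have inv: "inv_into {..<m} \<iota> (\<iota> k) = k" if "\<iota> \<in> injections m N" "k < m" for \<iota> k
    using injectionsD(1)[OF that(1)] that(2) by simp
  have F: "F = (\<lambda>xs. \<Sum>\<iota>\<in>injections m N. \<Sum>p | p permutes {..<m}. of_int (sign p) * (\<Prod>i<N. G \<iota> p i (xs i)))"
  proof
    fix xs
    have "F xs = (\<Sum>\<iota>\<in>injections m N. \<Sum>p | p permutes {..<m}. of_int (sign p) *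
        ((\<Prod>k<m. (1 / w (xs (\<iota> k)) * \<phi> k (xs (\<iota> k))) * \<phi> (p k) (xs (\<iota> k))) * (\<Prod>i<N. g i (xs i))))"
      unfolding F_def PhiTPhi_def det_sum_rank_one by (simp only: sum_distrib_right mult.assoc)
    also have "\<dots> = (\<Sum>\<iota>\<in>injections m N. \<Sum>p | p permutes {..<m}. of_int (sign p) * (\<Prod>i<N. G \<iota> p i (xs i)))"
    proof (intro sum.cong refl arg_cong2[of _ _ _ _ "(*)"])
      fix \<iota> p assume \<iota>: "\<iota> \<in> injections m N"
      have "(\<Prod>i\<in>{..<N} - \<iota> ` {..<m}. G \<iota> p i (xs i)) = (\<Prod>i\<in>{..<N} - \<iota> ` {..<m}. g i (xs i))"
        by (intro prod.cong) (auto simp: G_def)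
      moreover have "(\<Prod>k<m. G \<iota> p (\<iota> k) (xs (\<iota> k))) =
          (\<Prod>k<m. (1 / w (xs (\<iota> k)) * \<phi> k (xs (\<iota> k))) * \<phi> (p k) (xs (\<iota> k))) * (\<Prod>k<m. g (\<iota> k) (xs (\<iota> k)))"
        unfolding prod.distrib[symmetric] by (intro prod.cong) (auto simp: G_def inv[OF \<iota>])
      ultimately show "(\<Prod>k<m. (1 / w (xs (\<iota> k)) * \<phi> k (xs (\<iota> k))) * \<phi> (p k) (xs (\<iota> k))) * (\<Prod>i<N. g i (xs i)) =
          (\<Prod>i<N. G \<iota> p i (xs i))"
        by (simp add: split[OF \<iota>])
    qed
    finally show "F xs = (\<Sum>\<iota>\<in>injections m N. \<Sum>p | p permutes {..<m}. of_int (sign p) * (\<Prod>i<N. G \<iota> p i (xs i)))" .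
  qed
  have G_in: "integrable \<nu> (G \<iota> p (\<iota> k)) \<and> integral\<^sup>L \<nu> (G \<iota> p (\<iota> k)) = moment (g (\<iota> k)) k (p k)"
    if \<iota>: "\<iota> \<in> injections m N" and p: "p permutes {..<m}" and k: "k < m" for \<iota> p k
  proof -
    have pk: "p k < m" using permutes_in_image[OF p, of k] k by simp
    have adm: "admissible (g (\<iota> k))" using g injectionsD(2)[OF \<iota> k] .
    have G: "G \<iota> p (\<iota> k) = (\<lambda>x. g (\<iota> k) x * (1 / w x * \<phi> k x * \<phi> (p k) x))"
      using k by (auto simp: G_def inv[OF \<iota>])
    have meas: "G \<iota> p (\<iota> k) \<in> borel_measurable M"
      unfolding G using adm k pk by (auto simp: admissible_def)
    have "w x * G \<iota> p (\<iota> k) x = g (\<iota> k) x * (\<phi> k x * \<phi> (p k) x)" for x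
      by (cases "w x = 0") (auto simp: G phi_eq_0[OF k])
    then show ?thesis
      using adm k pk by (simp add: integral_nu[OF meas] moment_def admissible_def)
  qed
  have G_out: "integrable \<nu> (G \<iota> p i) \<and> integral\<^sup>L \<nu> (G \<iota> p i) = mean (g i)"
    if "i \<in> {..<N} - \<iota> ` {..<m}" for \<iota> p i
  proof -
    have G: "G \<iota> p i = g i" using that by (auto simp: G_def)
    show ?thesis using g[of i] that by (simp add: G integral_nu admissible_def mean_def)
  qed
  have G_int: "integrable \<nu> (G \<iota> p i)" if "\<iota> \<in> injections m N" "p permutes {..<m}" "i < N" for \<iota> p i
    using G_in[OF that(1,2)] G_out[of i \<iota> p] that(3) by (cases "i \<in> \<iota> ` {..<m}") auto
  have int: "integrable (PiM {..<N} (\<lambda>_. \<nu>)) (\<lambda>xs. \<Prod>i<N. G \<iota> p i (xs i))"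
    if "\<iota> \<in> injections m N" "p permutes {..<m}" for \<iota> p
    using G_int[OF that] by (intro Q.product_integrable_prod) auto
  show "integrable (PiM {..<N} (\<lambda>_. \<nu>)) F"
    unfolding F using int by (intro Bochner_Integration.integrable_sum integrable_mult_right) auto
  have val: "integral\<^sup>L (PiM {..<N} (\<lambda>_. \<nu>)) (\<lambda>xs. \<Prod>i<N. G \<iota> p i (xs i)) =
      (\<Prod>k<m. moment (g (\<iota> k)) k (p k)) * (\<Prod>i\<in>{..<N} - \<iota> ` {..<m}. mean (g i))"
    if "\<iota> \<in> injections m N" "p permutes {..<m}" for \<iota> p
  proof -
    have "integral\<^sup>L (PiM {..<N} (\<lambda>_. \<nu>)) (\<lambda>xs. \<Prod>i<N. G \<iota> p i (xs i)) = (\<Prod>i<N. integral\<^sup>L \<nu> (G \<iota> p i))"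
      using G_int[OF that] by (intro Q.product_integral_prod) auto
    then show ?thesis
      using G_in[OF that] G_out[of _ \<iota> p] by (simp add: split[OF that(1)])
  qed
  let ?Q = "PiM {..<N} (\<lambda>_. \<nu>)"
  have "integral\<^sup>L ?Q F = (\<Sum>\<iota>\<in>injections m N. \<integral>xs. (\<Sum>p | p permutes {..<m}. of_int (sign p) * (\<Prod>i<N. G \<iota> p i (xs i))) \<partial>?Q)"
    unfolding F using int
    by (intro Bochner_Integration.integral_sum Bochner_Integration.integrable_sum integrable_mult_right) auto
  also have "\<dots> = (\<Sum>\<iota>\<in>injections m N. \<Sum>p | p permutes {..<m}. of_int (sign p) * (\<integral>xs. (\<Prod>i<N. G \<iota> p i (xs i)) \<partial>?Q))"
    using int by (intro sum.cong refl, subst Bochner_Integration.integral_sum) auto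
  also have "\<dots> = (\<Sum>\<iota>\<in>injections m N. (\<Sum>p | p permutes {..<m}. of_int (sign p) * (\<Prod>k<m. moment (g (\<iota> k)) k (p k))) *
        (\<Prod>i\<in>{..<N} - \<iota> ` {..<m}. mean (g i)))"
    by (intro sum.cong refl) (simp add: val sum_distrib_right mult.assoc)
  finally show "integral\<^sup>L ?Q F =
      (\<Sum>\<iota>\<in>injections m N. (\<Sum>p | p permutes {..<m}. of_int (sign p) * (\<Prod>k<m. moment (g (\<iota> k)) k (p k))) *
        (\<Prod>i\<in>{..<N} - \<iota> ` {..<m}. mean (g i)))" .
qed

section \<open>Expectations under the volume sampling measure\<close>

lemma gamma_prod:
  assumes g: "\<And>i. i < N \<Longrightarrow> admissible (g i)"
  shows "integrable (gamma_vs M \<phi> m w N) (\<lambda>xs. \<Prod>i<N. g i (xs i))"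
    and "(\<integral>xs. (\<Prod>i<N. g i (xs i)) \<partial>gamma_vs M \<phi> m w N) = fact (N - m) / fact N *
      (\<Sum>\<iota>\<in>injections m N. (\<Sum>p | p permutes {..<m}. of_int (sign p) * (\<Prod>k<m. moment (g (\<iota> k)) k (p k))) *
        (\<Prod>i\<in>{..<N} - \<iota> ` {..<m}. mean (g i)))"
proof -
  let ?Q = "PiM {..<N} (\<lambda>_. \<nu>)"
  let ?D = "\<lambda>xs. fact (N - m) / fact N * det (PhiTPhi \<phi> m w N xs)"
  \<comment> \<open>Measurability of the determinant is read off from its integrability, the case of
    constant factors 1.\<close>
  have "integrable ?Q (\<lambda>xs. det (PhiTPhi \<phi> m w N xs))"
    using integral_det_prod(1)[of N "\<lambda>_ _. 1"] admissible_one by simp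
  then have D [measurable]: "?D \<in> borel_measurable ?Q" by simp
  have [measurable]: "g i \<in> borel_measurable \<nu>" if "i < N" for i
    using g[OF that] by (simp add: admissible_def)
  have P [measurable]: "(\<lambda>xs. \<Prod>i<N. g i (xs i)) \<in> borel_measurable ?Q" by measurable
  have nonneg: "AE xs in ?Q. 0 \<le> ?D xs"
    by (intro AE_I2 mult_nonneg_nonneg divide_nonneg_nonneg det_PhiTPhi_nonneg w_nonneg) auto
  have eq: "?D xs *\<^sub>R (\<Prod>i<N. g i (xs i)) =
      fact (N - m) / fact N * (det (PhiTPhi \<phi> m w N xs) * (\<Prod>i<N. g i (xs i)))" for xs
    by simp
  show "integrable (gamma_vs M \<phi> m w N) (\<lambda>xs. \<Prod>i<N. g i (xs i))"
    unfolding gamma_vs_def integrable_density[OF P D nonneg] eq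
    using integral_det_prod(1)[OF g] by simp
  show "(\<integral>xs. (\<Prod>i<N. g i (xs i)) \<partial>gamma_vs M \<phi> m w N) = fact (N - m) / fact N *
      (\<Sum>\<iota>\<in>injections m N. (\<Sum>p | p permutes {..<m}. of_int (sign p) * (\<Prod>k<m. moment (g (\<iota> k)) k (p k))) *
        (\<Prod>i\<in>{..<N} - \<iota> ` {..<m}. mean (g i)))"
    unfolding gamma_vs_def integral_density[OF P D nonneg] eq
    using integral_det_prod(2)[OF g] by simp
qed

text \<open>The contribution of \<open>\<iota>\<close> to the expectation of \<open>\<Prod>i\<in>J. u (xs i)\<close> under \<open>gamma_vs\<close>, up to normalisation.\<close>
definition injection_term :: "('a \<Rightarrow> real) \<Rightarrow> nat set \<Rightarrow> (nat \<Rightarrow> nat) \<Rightarrow> real" where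
  "injection_term u J \<iota> = (\<Sum>p | p permutes {..<m}. of_int (sign p) *
      (\<Prod>k<m. if \<iota> k \<in> J then moment u k (p k) else if k = p k then 1 else 0)) * mean u ^ card (J - \<iota> ` {..<m})"

text \<open>Factors 1 off \<open>J\<close> complete the product to all points; by orthonormality the
  rows sent outside \<open>J\<close> become rows of the identity.\<close>

lemma gamma_prod_subset:
  assumes u: "admissible u" and J: "J \<subseteq> {..<N}"
  shows "integrable (gamma_vs M \<phi> m w N) (\<lambda>xs. \<Prod>i\<in>J. u (xs i))"
    and "(\<integral>xs. (\<Prod>i\<in>J. u (xs i)) \<partial>gamma_vs M \<phi> m w N) =
      fact (N - m) / fact N * (\<Sum>\<iota>\<in>injections m N. injection_term u J \<iota>)"
proof -
  define g where "g i = (if i \<in> J then u else (\<lambda>_. 1))" for i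
  have g: "admissible (g i)" for i using u admissible_one by (simp add: g_def)
  have prod: "(\<lambda>xs. \<Prod>i\<in>J. u (xs i)) = (\<lambda>xs. \<Prod>i<N. g i (xs i))"
  proof
    fix xs
    have "{..<N} \<inter> J = J" using J by auto
    then show "(\<Prod>i\<in>J. u (xs i)) = (\<Prod>i<N. g i (xs i))"
      using prod.inter_restrict[of "{..<N}" "\<lambda>i. u (xs i)" J]
      by (simp add: g_def if_distrib[of "\<lambda>h. h _"] cong: if_cong)
  qed
  show "integrable (gamma_vs M \<phi> m w N) (\<lambda>xs. \<Prod>i\<in>J. u (xs i))"
    unfolding prod by (rule gamma_prod(1)) (rule g)
  have "(\<Sum>p | p permutes {..<m}. of_int (sign p) * (\<Prod>k<m. moment (g (\<iota> k)) k (p k))) *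
        (\<Prod>i\<in>{..<N} - \<iota> ` {..<m}. mean (g i)) = injection_term u J \<iota>" for \<iota>
    unfolding injection_term_def
  proof (intro arg_cong2[of _ _ _ _ "(*)"] sum.cong refl prod.cong)
    fix p k assume "p \<in> {p. p permutes {..<m}}" "k \<in> {..<m}"
    then have "k < m" "p k < m" using permutes_in_image[of p "{..<m}" k] by auto
    then show "moment (g (\<iota> k)) k (p k) = (if \<iota> k \<in> J then moment u k (p k) else if k = p k then 1 else 0)"
      by (simp add: g_def moment_one)
  next
    have "({..<N} - \<iota> ` {..<m}) \<inter> J = J - \<iota> ` {..<m}" using J by auto
    moreover have "(\<Prod>i\<in>({..<N} - \<iota> ` {..<m}) \<inter> J. mean u) = (\<Prod>i\<in>{..<N} - \<iota> ` {..<m}. if i \<in> J then mean u else 1)"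
      by (rule prod.inter_restrict) simp
    ultimately show "(\<Prod>i\<in>{..<N} - \<iota> ` {..<m}. mean (g i)) = mean u ^ card (J - \<iota> ` {..<m})"
      by (simp add: g_def mean_one if_distrib[of mean] cong: if_cong)
  qed
  then show "(\<integral>xs. (\<Prod>i\<in>J. u (xs i)) \<partial>gamma_vs M \<phi> m w N) =
      fact (N - m) / fact N * (\<Sum>\<iota>\<in>injections m N. injection_term u J \<iota>)"
    unfolding prod by (subst gamma_prod(2)) (auto simp: g)
qed

text \<open>If every injection contributes the same \<open>c\<close>, the expectation is
  \<open>c\<close>.\<close>

lemma fact_mult_card_injections: "m \<le> N \<Longrightarrow> fact (N - m) / fact N * (real (card (injections m N)) * c) = (c :: real)"
  by (simp add: card_injections)

lemma injection_term_empty: "injection_term u {} \<iota> = 1"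
  using sum_permutations_identity_but_two_rows[of 0 m 0 "\<lambda>k l. if k = l then 1 else 0 :: real"] m_pos
  by (simp add: injection_term_def)

text \<open>The total mass is the expectation of the empty product, to which every injection
  contributes 1.\<close>

lemma prob_gamma:
  assumes N: "m \<le> N"
  shows "prob_space (gamma_vs M \<phi> m w N)"
proof -
  let ?\<gamma> = "gamma_vs M \<phi> m w N"
  have "injections m N \<noteq> {}" using card_injections[OF N] by auto
  then have "(\<integral>xs. 1 \<partial>?\<gamma>) = (1 :: real)"
    using gamma_prod_subset(2)[OF admissible_one, of "{}" N] fact_mult_card_injections[OF N, of 1]
    by (simp add: injection_term_empty)
  then have "measure ?\<gamma> (space ?\<gamma>) = 1" by simp
  \<comment> \<open>\<open>measure\<close> returns 0 on infinite mass, so the value 1 also excludes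
    that case.\<close>
  then have "emeasure ?\<gamma> (space ?\<gamma>) = 1"
    by (metis emeasure_eq_ennreal_measure ennreal_1 enn2real_top measure_def zero_neq_one)
  then show ?thesis by (rule prob_spaceI)
qed

text \<open>At most one row differs from the identity: a point in the range brings the diagonal
  moment of its row, a point outside it is an independent draw from \<open>\<nu>\<close>.\<close>

lemma injection_term_single:
  assumes \<iota>: "\<iota> \<in> injections m N"
  shows "injection_term u {j} \<iota> =
    (if j \<in> \<iota> ` {..<m} then moment u (inv_into {..<m} \<iota> j) (inv_into {..<m} \<iota> j) else mean u)"
proof (cases "j \<in> \<iota> ` {..<m}")
  case True
  then obtain q where q: "q < m" "j = \<iota> q" by auto
  have eq: "\<iota> k = \<iota> q \<longleftrightarrow> k = q" if "k < m" for k
    using injectionsD(1)[OF \<iota>] q that by (auto simp: inj_on_def)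
  have "injection_term u {j} \<iota> = (\<Sum>p | p permutes {..<m}. of_int (sign p) *
      (\<Prod>k<m. if k = q then moment u k (p k) else if k = p k then 1 else 0))"
    using True eq by (auto simp: injection_term_def q intro!: sum.cong prod.cong)
  also have "\<dots> = moment u q q"
    using sum_permutations_identity_but_two_rows[of q m q "\<lambda>k l. if k = q then moment u k l else if k = l then 1 else 0"] q
    by simp
  finally show ?thesis using True q injectionsD(1)[OF \<iota>] by simp
next
  case False
  then have "{j} - \<iota> ` {..<m} = {j}" by auto
  then have "injection_term u {j} \<iota> = injection_term u {} \<iota> * mean u"
    using False by (auto simp: injection_term_def intro!: sum.cong prod.cong)
  with False show ?thesis by (simp add: injection_term_empty)
qed

text \<open>The total does not depend on the injection: its range meets every diagonal moment once
  and leaves \<open>N - m\<close> points with the plain mean.\<close>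

lemma gamma_linear:
  assumes u: "admissible u"
  shows "i < N \<Longrightarrow> integrable (gamma_vs M \<phi> m w N) (\<lambda>xs. u (xs i))"
    and "m \<le> N \<Longrightarrow> (\<integral>xs. (\<Sum>i<N. u (xs i)) \<partial>gamma_vs M \<phi> m w N) =
      real (N - m) * mean u + (\<Sum>k<m. moment u k k)"
proof -
  show int: "integrable (gamma_vs M \<phi> m w N) (\<lambda>xs. u (xs i))" if "i < N" for i
    using gamma_prod_subset(1)[OF u, of "{i}" N] that by simp
  assume N: "m \<le> N"
  have "(\<integral>xs. (\<Sum>i<N. u (xs i)) \<partial>gamma_vs M \<phi> m w N) =
      (\<Sum>i<N. fact (N - m) / fact N * (\<Sum>\<iota>\<in>injections m N. injection_term u {i} \<iota>))"
    using gamma_prod_subset(2)[OF u, of "{_}" N] int by (simp add: Bochner_Integration.integral_sum)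
  also have "\<dots> = fact (N - m) / fact N * (\<Sum>\<iota>\<in>injections m N. \<Sum>i<N. injection_term u {i} \<iota>)"
    unfolding sum_distrib_left[symmetric] by (subst sum.swap) simp
  also have "(\<Sum>\<iota>\<in>injections m N. \<Sum>i<N. injection_term u {i} \<iota>) =
      (\<Sum>\<iota>\<in>injections m N. real (N - m) * mean u + (\<Sum>k<m. moment u k k))"
  proof (rule sum.cong[OF refl])
    fix \<iota> assume \<iota>: "\<iota> \<in> injections m N"
    note inj = injectionsD[OF \<iota>]
    have "(\<Sum>i<N. injection_term u {i} \<iota>) = (\<Sum>i\<in>{..<N} - \<iota> ` {..<m}. injection_term u {i} \<iota>) + (\<Sum>i\<in>\<iota> ` {..<m}. injection_term u {i} \<iota>)"
      using inj by (intro sum.subset_diff) auto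
    also have "(\<Sum>i\<in>{..<N} - \<iota> ` {..<m}. injection_term u {i} \<iota>) = real (N - m) * mean u"
      using inj by (simp add: injection_term_single[OF \<iota>] card_Diff_subset card_image)
    also have "(\<Sum>i\<in>\<iota> ` {..<m}. injection_term u {i} \<iota>) = (\<Sum>k<m. moment u k k)"
      using inj by (subst sum.reindex) (auto simp: injection_term_single[OF \<iota>] intro!: sum.cong)
    finally show "(\<Sum>i<N. injection_term u {i} \<iota>) = real (N - m) * mean u + (\<Sum>k<m. moment u k k)" .
  qed
  finally show "(\<integral>xs. (\<Sum>i<N. u (xs i)) \<partial>gamma_vs M \<phi> m w N) =
      real (N - m) * mean u + (\<Sum>k<m. moment u k k)"
    using fact_mult_card_injections[OF N, of "real (N - m) * mean u + (\<Sum>k<m. moment u k k)"] by simp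
qed

text \<open>A centred point outside the range is independent of the rest and annihilates the term;
  two points in the range change two rows and leave a minor of the moment matrix.\<close>

lemma injection_term_pair:
  assumes \<iota>: "\<iota> \<in> injections m N" and ij: "i \<noteq> j" and mean: "mean u = 0"
  shows "i \<notin> \<iota> ` {..<m} \<or> j \<notin> \<iota> ` {..<m} \<Longrightarrow> injection_term u {i, j} \<iota> = 0"
    and "a < m \<Longrightarrow> b < m \<Longrightarrow> i = \<iota> a \<Longrightarrow> j = \<iota> b \<Longrightarrow>
      injection_term u {i, j} \<iota> = moment u a a * moment u b b - (moment u a b)\<^sup>2"
proof -
  assume "i \<notin> \<iota> ` {..<m} \<or> j \<notin> \<iota> ` {..<m}"
  then have "{i, j} - \<iota> ` {..<m} \<noteq> {}" by auto
  then have "card ({i, j} - \<iota> ` {..<m}) \<noteq> 0" by (subst card_0_eq) auto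
  then show "injection_term u {i, j} \<iota> = 0" 
    by (simp only: injection_term_def mean power_0_left if_False mult_zero_right)
next
  assume ab: "a < m" "b < m" "i = \<iota> a" "j = \<iota> b"
  have eq: "\<iota> k = \<iota> l \<longleftrightarrow> k = l" if "k < m" "l < m" for k l
    using injectionsD(1)[OF \<iota>] that by (auto simp: inj_on_def)
  have "{i, j} - \<iota> ` {..<m} = {}" using ab by auto
  then have "injection_term u {i, j} \<iota> = (\<Sum>p | p permutes {..<m}. of_int (sign p) *
      (\<Prod>k<m. if k = a \<or> k = b then moment u k (p k) else if k = p k then 1 else 0))"
    using ab by (auto simp: injection_term_def eq intro!: sum.cong prod.cong)
  also have "\<dots> = moment u a a * moment u b b - moment u a b * moment u b a"
    using sum_permutations_identity_but_two_rows[of a m b "\<lambda>k l. if k = a \<or> k = b then moment u k l else if k = l then 1 else 0"] ab ij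
    by auto
  finally show "injection_term u {i, j} \<iota> = moment u a a * moment u b b - (moment u a b)\<^sup>2"
    by (simp add: moment_commute[of u b a] power2_eq_square)
qed

text \<open>Over ordered pairs, the two by two minors of the symmetric moment matrix add up to
  squared trace minus squared Frobenius norm; with zero trace the points are on balance negatively
  correlated.\<close>

lemma gamma_quadratic:
  assumes u: "admissible u" and mean: "mean u = 0"
  shows "i < N \<Longrightarrow> j < N \<Longrightarrow> i \<noteq> j \<Longrightarrow> integrable (gamma_vs M \<phi> m w N) (\<lambda>xs. u (xs i) * u (xs j))"
    and "m \<le> N \<Longrightarrow> (\<Sum>i<N. \<Sum>j\<in>{..<N} - {i}. \<integral>xs. u (xs i) * u (xs j) \<partial>gamma_vs M \<phi> m w N) =
      (\<Sum>k<m. moment u k k)\<^sup>2 - (\<Sum>k<m. \<Sum>l<m. (moment u k l)\<^sup>2)"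
proof -
  have prod: "(\<Prod>l\<in>{i, j}. u (xs l)) = u (xs i) * u (xs j)" if "i \<noteq> j" for xs i j
    using that by simp
  show "integrable (gamma_vs M \<phi> m w N) (\<lambda>xs. u (xs i) * u (xs j))" if "i < N" "j < N" "i \<noteq> j"
    using gamma_prod_subset(1)[OF u, of "{i, j}" N] that unfolding prod[OF that(3)] by simp
  assume N: "m \<le> N"
  have "(\<integral>xs. u (xs i) * u (xs j) \<partial>gamma_vs M \<phi> m w N) =
      fact (N - m) / fact N * (\<Sum>\<iota>\<in>injections m N. injection_term u {i, j} \<iota>)" if "i < N" "j \<in> {..<N} - {i}" for i j
    using gamma_prod_subset(2)[OF u, of "{i, j}" N] that prod[of i j] by auto
  then have "(\<Sum>i<N. \<Sum>j\<in>{..<N} - {i}. \<integral>xs. u (xs i) * u (xs j) \<partial>gamma_vs M \<phi> m w N) =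
      (\<Sum>i<N. \<Sum>j\<in>{..<N} - {i}. fact (N - m) / fact N * (\<Sum>\<iota>\<in>injections m N. injection_term u {i, j} \<iota>))"
    by simp
  also have "\<dots> = fact (N - m) / fact N * (\<Sum>\<iota>\<in>injections m N. \<Sum>i<N. \<Sum>j\<in>{..<N} - {i}. injection_term u {i, j} \<iota>)"
    unfolding sum_distrib_left[symmetric]
    by (simp add: sum.swap[of _ "injections m N"])
  also have "(\<Sum>\<iota>\<in>injections m N. \<Sum>i<N. \<Sum>j\<in>{..<N} - {i}. injection_term u {i, j} \<iota>) =
      (\<Sum>\<iota>\<in>injections m N. (\<Sum>k<m. moment u k k)\<^sup>2 - (\<Sum>k<m. \<Sum>l<m. (moment u k l)\<^sup>2))"
  proof (rule sum.cong[OF refl])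
    fix \<iota> assume \<iota>: "\<iota> \<in> injections m N"
    note inj = injectionsD[OF \<iota>]
    let ?R = "\<iota> ` {..<m}"
    have img: "?R - {\<iota> a} = \<iota> ` ({..<m} - {a})" if "a < m" for a
      using inj(1) that by (auto simp: inj_on_def)
    have "(\<Sum>i<N. \<Sum>j\<in>{..<N} - {i}. injection_term u {i, j} \<iota>) = (\<Sum>i\<in>?R. \<Sum>j\<in>{..<N} - {i}. injection_term u {i, j} \<iota>)"
      using inj(3) by (intro sum.mono_neutral_right ballI sum.neutral)
        (auto intro!: injection_term_pair(1)[OF \<iota> _ mean])
    also have "\<dots> = (\<Sum>i\<in>?R. \<Sum>j\<in>?R - {i}. injection_term u {i, j} \<iota>)"
      using inj(3) by (intro sum.cong refl sum.mono_neutral_right ballI)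
        (auto intro!: injection_term_pair(1)[OF \<iota> _ mean])
    also have "\<dots> = (\<Sum>a<m. \<Sum>j\<in>?R - {\<iota> a}. injection_term u {\<iota> a, j} \<iota>)"
      using inj(1) by (subst sum.reindex) auto
    also have "\<dots> = (\<Sum>a<m. \<Sum>b\<in>{..<m} - {a}. injection_term u {\<iota> a, \<iota> b} \<iota>)"
    proof (rule sum.cong[OF refl])
      fix a assume "a \<in> {..<m}"
      moreover have "inj_on \<iota> ({..<m} - {a})" using inj(1) by (auto intro: inj_on_subset)
      ultimately show "(\<Sum>j\<in>?R - {\<iota> a}. injection_term u {\<iota> a, j} \<iota>) = (\<Sum>b\<in>{..<m} - {a}. injection_term u {\<iota> a, \<iota> b} \<iota>)"
        using img[of a] by (simp add: sum.reindex)
    qed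
    also have "\<dots> = (\<Sum>a<m. \<Sum>b\<in>{..<m} - {a}. moment u a a * moment u b b - (moment u a b)\<^sup>2)"
      using inj(1) by (intro sum.cong refl injection_term_pair(2)[OF \<iota> _ mean]) (auto simp: inj_on_def)
    \<comment> \<open>The terms with \<open>a = b\<close> are zero and may be added.\<close>
    also have "\<dots> = (\<Sum>a<m. \<Sum>b<m. moment u a a * moment u b b - (moment u a b)\<^sup>2)"
      by (intro sum.cong refl sum.mono_neutral_left) (auto simp: power2_eq_square)
    also have "\<dots> = (\<Sum>k<m. moment u k k)\<^sup>2 - (\<Sum>k<m. \<Sum>l<m. (moment u k l)\<^sup>2)"
      by (simp add: sum_subtractf power2_eq_square sum_product)
    finally show "(\<Sum>i<N. \<Sum>j\<in>{..<N} - {i}. injection_term u {i, j} \<iota>) =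
        (\<Sum>k<m. moment u k k)\<^sup>2 - (\<Sum>k<m. \<Sum>l<m. (moment u k l)\<^sup>2)" .
  qed
  finally show "(\<Sum>i<N. \<Sum>j\<in>{..<N} - {i}. \<integral>xs. u (xs i) * u (xs j) \<partial>gamma_vs M \<phi> m w N) =
      (\<Sum>k<m. moment u k k)\<^sup>2 - (\<Sum>k<m. \<Sum>l<m. (moment u k l)\<^sup>2)"
    using fact_mult_card_injections[OF N, of "(\<Sum>k<m. moment u k k)\<^sup>2 - (\<Sum>k<m. \<Sum>l<m. (moment u k l)\<^sup>2)"] by simp
qed

end

subsection \<open>Bounds for the projection residual\<close>

lemma sum_flatten:
  "(\<Sum>i<N * r. F (flatten N X i)) = (\<Sum>b<r. \<Sum>i<N. F (X b i))"
proof -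
  have "(\<Sum>i<N * r. F (flatten N X i)) = (\<Sum>b<r. \<Sum>i\<in>{b * N..<b * N + N}. F (flatten N X i))"
    by (subst sum.nat_group) (simp add: mult.commute)
  also have "\<dots> = (\<Sum>b<r. \<Sum>i<N. F (X b i))"
  proof (rule sum.cong[OF refl])
    fix b
    have "(\<Sum>i\<in>{b * N..<b * N + N}. F (flatten N X i)) = (\<Sum>i\<in>{0..<N}. F (flatten N X (i + b * N)))"
      using sum.shift_bounds_nat_ivl[of "\<lambda>i. F (flatten N X i)" 0 "b * N" N] by (simp add: add.commute)
    also have "\<dots> = (\<Sum>i<N. F (X b i))"
      by (intro sum.cong) (auto simp: flatten_def)
    finally show "(\<Sum>i\<in>{b * N..<b * N + N}. F (flatten N X i)) = (\<Sum>i<N. F (X b i))" .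
  qed
  finally show ?thesis .
qed

lemma integrable_mult_square_integrable:
  fixes f g :: "'a \<Rightarrow> real"
  assumes [measurable]: "f \<in> borel_measurable M" "g \<in> borel_measurable M"
    and "integrable M (\<lambda>x. (f x)\<^sup>2)" "integrable M (\<lambda>x. (g x)\<^sup>2)"
  shows "integrable M (\<lambda>x. f x * g x)"
proof (rule Bochner_Integration.integrable_bound)
  show "integrable M (\<lambda>x. (f x)\<^sup>2 + (g x)\<^sup>2)" using assms by simp
  show "AE x in M. norm (f x * g x) \<le> norm ((f x)\<^sup>2 + (g x)\<^sup>2)"
  proof (rule AE_I2)
    fix x
    have "2 * \<bar>f x * g x\<bar> \<le> (f x)\<^sup>2 + (g x)\<^sup>2"
      using zero_le_power2[of "\<bar>f x\<bar> - \<bar>g x\<bar>"] by (simp add: power2_diff abs_mult)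
    moreover have "2 * t \<le> a \<Longrightarrow> 0 \<le> a \<Longrightarrow> t \<le> a" for t a :: real
      by linarith
    ultimately have "\<bar>f x * g x\<bar> \<le> (f x)\<^sup>2 + (g x)\<^sup>2"
      using sum_power2_ge_zero by blast
    then show "norm (f x * g x) \<le> norm ((f x)\<^sup>2 + (g x)\<^sup>2)"
      by simp
  qed
qed measurable

text \<open>Conditioning costs only the factor \<open>1 / measure P S\<close>: the constant
  \<open>A\<close> is integrated over \<open>S\<close> alone and keeps its coefficient, whereas the
  nonnegative \<open>T\<close> is integrated over the whole space.\<close>

lemma cond_exp_event_le:
  assumes P: "prob_space P" and S: "S \<in> sets P" "measure P S > 0"
    and T: "integrable P T" "\<And>X. X \<in> space P \<Longrightarrow> T X \<ge> 0" "integral\<^sup>L P T \<le> \<tau>"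
    and A: "A \<ge> 0" and K: "K \<ge> 0"
    and Z: "\<And>X. X \<in> S \<Longrightarrow> Z X \<le> A + K * T X"
  shows "cond_exp_event P S Z \<le> ennreal (A + (1 / measure P S) * K * \<tau>)"
proof -
  interpret prob_space P by fact
  have "(\<integral>\<^sup>+ X \<in> S. ennreal (Z X) \<partial>P) \<le> (\<integral>\<^sup>+ X. ennreal (A * indicator S X + K * T X) \<partial>P)"
  proof (rule nn_integral_mono)
    fix X assume "X \<in> space P"
    then show "ennreal (Z X) * indicator S X \<le> ennreal (A * indicator S X + K * T X)"
      using Z[of X] T(2)[of X] K by (cases "X \<in> S") (auto intro: ennreal_leI)
  qed
  also have "\<dots> = ennreal (\<integral>X. A * indicator S X + K * T X \<partial>P)"
    using T A K S
    by (intro nn_integral_eq_integral Bochner_Integration.integrable_add integrable_mult_right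
          integrable_real_indicator AE_I2 add_nonneg_nonneg mult_nonneg_nonneg)
       (auto simp: less_top[symmetric])
  also have "(\<integral>X. A * indicator S X + K * T X \<partial>P) = A * measure P S + K * integral\<^sup>L P T"
  proof -
    have "integrable P (\<lambda>X. A * indicat_real S X)"
      using S(1) by (intro integrable_mult_right integrable_real_indicator) (auto simp: less_top[symmetric])
    then show ?thesis
      using T(1) S(1) by (subst Bochner_Integration.integral_add) auto
  qed
  also have "ennreal \<dots> \<le> ennreal (A * measure P S + K * \<tau>)"
    using T K by (intro ennreal_leI add_left_mono mult_left_mono) auto
  finally have "cond_exp_event P S Z \<le> ennreal (A * measure P S + K * \<tau>) / emeasure P S"
    unfolding cond_exp_event_def by (rule divide_right_mono_ennreal)
  also have "\<dots> = ennreal ((A * measure P S + K * \<tau>) / measure P S)"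
  proof -
    have "0 \<le> integral\<^sup>L P T" using T(2) by (intro Bochner_Integration.integral_nonneg) auto
    then have "0 \<le> \<tau>" using T(3) by linarith
    then show ?thesis
      unfolding emeasure_eq_measure using S A K by (intro divide_ennreal) auto
  qed
  also have "(A * measure P S + K * \<tau>) / measure P S = A + (1 / measure P S) * K * \<tau>"
    using S by (simp add: field_simps)
  finally show ?thesis .
qed

section \<open>Independent blocks\<close>

lemma PiM_block_integral:
  fixes Y :: "'a \<Rightarrow> real"
  assumes \<Gamma>: "prob_space \<Gamma>" and Y: "integrable \<Gamma> Y" and b: "b < (r::nat)"
  shows "integrable (PiM {..<r} (\<lambda>_. \<Gamma>)) (\<lambda>X. Y (X b))"
    and "(\<integral>X. Y (X b) \<partial>PiM {..<r} (\<lambda>_. \<Gamma>)) = integral\<^sup>L \<Gamma> Y"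
proof -
  let ?P = "PiM {..<r} (\<lambda>_. \<Gamma>)"
  have d: "distr ?P \<Gamma> (\<lambda>X. X b) = \<Gamma>"
    using \<Gamma> b by (intro distr_PiM_component) auto
  have m [measurable]: "(\<lambda>X. X b) \<in> measurable ?P \<Gamma>"
    using b by (intro measurable_component_singleton) auto
  show "integrable ?P (\<lambda>X. Y (X b))"
    using integrable_distr[OF m, of Y] d Y by simp
  show "(\<integral>X. Y (X b) \<partial>?P) = integral\<^sup>L \<Gamma> Y"
    using integral_distr[OF m, of Y] d Y by simp
qed

text \<open>Distinct blocks are independent and centred, so the cross terms of the square
  vanish.\<close>

lemma PiM_block_square_integral:
  fixes Y :: "'a \<Rightarrow> real"
  assumes \<Gamma>: "prob_space \<Gamma>" and Y: "integrable \<Gamma> Y" "integrable \<Gamma> (\<lambda>x. (Y x)\<^sup>2)" "integral\<^sup>L \<Gamma> Y = 0"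
  shows "integrable (PiM {..<r::nat} (\<lambda>_. \<Gamma>)) (\<lambda>X. (\<Sum>b<r. Y (X b))\<^sup>2)"
    and "(\<integral>X. (\<Sum>b<r. Y (X b))\<^sup>2 \<partial>PiM {..<r} (\<lambda>_. \<Gamma>)) = real r * (\<integral>x. (Y x)\<^sup>2 \<partial>\<Gamma>)"
proof -
  interpret \<Gamma>: prob_space \<Gamma> by fact
  interpret product_sigma_finite "\<lambda>_::nat. \<Gamma>" ..
  let ?P = "PiM {..<r} (\<lambda>_. \<Gamma>)"
  have pair: "integrable ?P (\<lambda>X. Y (X b) * Y (X c)) \<and>
      (\<integral>X. Y (X b) * Y (X c) \<partial>?P) = (if b = c then \<integral>x. (Y x)\<^sup>2 \<partial>\<Gamma> else 0)"
    if "b < r" "c < r" for b c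
  proof (cases "b = c")
    case True
    then show ?thesis
      using PiM_block_integral[OF \<Gamma> Y(2) that(1)] by (simp add: power2_eq_square)
  next
    case False
    \<comment> \<open>Filling up with constant factors 1 brings the mixed term into the form of a
      product integral.\<close>
    define F where "F a = (if a = b \<or> a = c then Y else (\<lambda>_. 1))" for a
    have F: "integrable \<Gamma> (F a)" for a using Y by (auto simp: F_def)
    have eq: "(\<Prod>a<r. G a) = G b * G c" if "\<And>a. a \<noteq> b \<Longrightarrow> a \<noteq> c \<Longrightarrow> G a = 1" for G :: "nat \<Rightarrow> real"
    proof -
      have "(\<Prod>a<r. G a) = (\<Prod>a\<in>{b, c}. G a)"
        using \<open>b < r\<close> \<open>c < r\<close> that by (intro prod.mono_neutral_right) auto
      then show ?thesis using False by simp
    qed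
    have "(\<Prod>a<r. F a (X a)) = Y (X b) * Y (X c)" for X
      by (subst eq) (auto simp: F_def)
    moreover have "(\<Prod>a<r. integral\<^sup>L \<Gamma> (F a)) = 0"
      using that Y(3) by (intro prod_zero) (auto simp: F_def intro!: bexI[of _ b])
    ultimately show ?thesis
      using product_integrable_prod[of "{..<r}" F] product_integral_prod[of "{..<r}" F] F False by simp
  qed
  have sq: "(\<lambda>X. (\<Sum>b<r. Y (X b))\<^sup>2) = (\<lambda>X. \<Sum>b<r. \<Sum>c<r. Y (X b) * Y (X c))"
    by (simp add: power2_eq_square sum_product)
  show "integrable ?P (\<lambda>X. (\<Sum>b<r. Y (X b))\<^sup>2)"
    unfolding sq using pair by (intro Bochner_Integration.integrable_sum) auto
  have "(\<integral>X. (\<Sum>b<r. Y (X b))\<^sup>2 \<partial>?P) = (\<Sum>b<r. \<integral>X. (\<Sum>c<r. Y (X b) * Y (X c)) \<partial>?P)"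
    unfolding sq using pair by (intro Bochner_Integration.integral_sum Bochner_Integration.integrable_sum) auto
  also have "\<dots> = (\<Sum>b<r. \<Sum>c<r. if b = c then \<integral>x. (Y x)\<^sup>2 \<partial>\<Gamma> else 0)"
    using pair by (intro sum.cong refl, subst Bochner_Integration.integral_sum) auto
  also have "\<dots> = real r * (\<integral>x. (Y x)\<^sup>2 \<partial>\<Gamma>)"
    by simp
  finally show "(\<integral>X. (\<Sum>b<r. Y (X b))\<^sup>2 \<partial>?P) = real r * (\<integral>x. (Y x)\<^sup>2 \<partial>\<Gamma>)" .
qed

section \<open>The residual and its empirical norm\<close>

locale weighted_onb_residual = weighted_onb +
  fixes h :: "'a \<Rightarrow> real" and N r :: nat
  assumes h_meas [measurable]: "h \<in> borel_measurable M"
    and h_L2: "integrable M (\<lambda>x. (h x)\<^sup>2)"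
    and h_orth: "\<And>k. k < m \<Longrightarrow> (\<integral>x. \<phi> k x * h x \<partial>M) = 0"
    and N: "m \<le> N" and r: "r > 0"
begin

abbreviation "hh \<equiv> \<integral>x. (h x)\<^sup>2 \<partial>M"

abbreviation "\<gamma> \<equiv> gamma_vs M \<phi> m w N"

abbreviation "\<P> \<equiv> PiM {..<r} (\<lambda>_. \<gamma>)"

definition "beta = 1 + (1 / \<alpha> - 1) * real m / real N"

definition H :: "'a \<Rightarrow> real" where "H x = (1 / w x) * (h x)\<^sup>2"

definition u :: "nat \<Rightarrow> 'a \<Rightarrow> real" where "u k x = (1 / w x) * (\<phi> k x * h x)"

lemma N_pos: "N > 0" using N m_pos by simp

lemma H_nonneg: "H x \<ge> 0" using w_nonneg by (simp add: H_def)

lemma H_meas [measurable]: "H \<in> borel_measurable M"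
  unfolding H_def by measurable

text \<open>Only an inequality: where \<open>w\<close> vanishes the left side is 0 although
  \<open>h\<close> may not be.\<close>

lemma wH_le: "w x * H x \<le> (h x)\<^sup>2"
  by (cases "w x = 0") (auto simp: H_def)

lemma H_phi_le:
  assumes "\<bar>t\<bar> \<le> real m / \<alpha> * w x"
  shows "\<bar>H x * t\<bar> \<le> real m / \<alpha> * (h x)\<^sup>2"
proof -
  have "\<bar>H x * t\<bar> = H x * \<bar>t\<bar>" using H_nonneg by (simp add: abs_mult)
  also have "\<dots> \<le> H x * (real m / \<alpha> * w x)"
    using assms H_nonneg by (intro mult_left_mono)
  also have "\<dots> = real m / \<alpha> * (w x * H x)" by simp
  also have "\<dots> \<le> real m / \<alpha> * (h x)\<^sup>2"
    using wH_le \<alpha>_pos by (intro mult_left_mono) auto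
  finally show ?thesis .
qed

lemma admissible_H: "admissible H"
  unfolding admissible_def
proof (intro conjI allI impI)
  show "integrable M (\<lambda>x. w x * H x)"
  proof (rule Bochner_Integration.integrable_bound[OF h_L2])
    show "AE x in M. norm (w x * H x) \<le> norm ((h x)\<^sup>2)"
      using wH_le w_nonneg H_nonneg by (intro AE_I2) (simp add: abs_mult)
  qed measurable
  fix k l assume kl: "k < m" "l < m"
  show "integrable M (\<lambda>x. H x * (\<phi> k x * \<phi> l x))"
  proof (rule Bochner_Integration.integrable_bound)
    show "integrable M (\<lambda>x. real m / \<alpha> * (h x)\<^sup>2)" using h_L2 by simp
    show "AE x in M. norm (H x * (\<phi> k x * \<phi> l x)) \<le> norm (real m / \<alpha> * (h x)\<^sup>2)"
      unfolding real_norm_def by (intro AE_I2 order.trans[OF H_phi_le[OF phi_prod_le[OF kl]] abs_ge_self])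
  qed (use kl in measurable)
qed simp

lemma mean_H_le: "mean H \<le> hh"
  unfolding mean_def using admissible_H wH_le h_L2
  by (intro integral_mono) (auto simp: admissible_def)

lemma moment_H_le: "(\<Sum>k<m. moment H k k) \<le> real m / \<alpha> * hh"
proof -
  have int: "integrable M (\<lambda>x. H x * (\<phi> k x * \<phi> k x))" if "k < m" for k
    using admissible_H that by (simp add: admissible_def)
  have "(\<Sum>k<m. moment H k k) = (\<integral>x. (\<Sum>k<m. H x * (\<phi> k x * \<phi> k x)) \<partial>M)"
    unfolding moment_def using int by (subst Bochner_Integration.integral_sum) auto
  also have "\<dots> \<le> (\<integral>x. real m / \<alpha> * (h x)\<^sup>2 \<partial>M)"
  proof (rule integral_mono)
    show "integrable M (\<lambda>x. \<Sum>k<m. H x * (\<phi> k x * \<phi> k x))"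
      using int by (intro Bochner_Integration.integrable_sum) auto
    show "integrable M (\<lambda>x. real m / \<alpha> * (h x)\<^sup>2)" using h_L2 by simp
    fix x
    have "(\<Sum>k<m. H x * (\<phi> k x * \<phi> k x)) = H x * (\<Sum>k<m. (\<phi> k x)\<^sup>2)"
      by (simp add: sum_distrib_left power2_eq_square)
    also have "\<dots> \<le> \<bar>H x * (\<Sum>k<m. (\<phi> k x)\<^sup>2)\<bar>" by (rule abs_ge_self)
    also have "\<dots> \<le> real m / \<alpha> * (h x)\<^sup>2"
      using sum_phi_sq_le[of x] by (intro H_phi_le) (simp add: sum_nonneg)
    finally show "(\<Sum>k<m. H x * (\<phi> k x * \<phi> k x)) \<le> real m / \<alpha> * (h x)\<^sup>2" .
  qed
  finally show ?thesis by simp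
qed

lemma gamma_H_le: "(\<integral>xs. (\<Sum>i<N. H (xs i)) \<partial>\<gamma>) \<le> real N * beta * hh"
proof -
  have "(\<integral>xs. (\<Sum>i<N. H (xs i)) \<partial>\<gamma>) = real (N - m) * mean H + (\<Sum>k<m. moment H k k)"
    by (rule gamma_linear(2)[OF admissible_H N])
  also have "\<dots> \<le> real (N - m) * hh + real m / \<alpha> * hh"
    using mean_H_le moment_H_le by (intro add_mono mult_left_mono) auto
  \<comment> \<open>Origin of \<open>beta\<close>: \<open>N * beta = (N - m) + m / \<alpha>\<close>,
    the free points counting 1 each and the \<open>m\<close> determinant points together
    \<open>m / \<alpha>\<close>.\<close>
  also have "\<dots> = real N * beta * hh"
    using N_pos N by (simp add: beta_def of_nat_diff field_simps)
  finally show ?thesis .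
qed

lemma emp_norm2_flatten:
  "emp_norm2 w (N * r) (flatten N X) h = (1 / real (N * r)) * (\<Sum>b<r. \<Sum>i<N. H (X b i))"
  unfolding emp_norm2_def H_def[symmetric] sum_flatten ..

lemma gamma_H_integrable: "integrable \<gamma> (\<lambda>xs. \<Sum>i<N. H (xs i))"
  using gamma_linear(1)[OF admissible_H] by (intro Bochner_Integration.integrable_sum) auto

lemma emp_norm2_expectation:
  shows "integrable \<P> (\<lambda>X. emp_norm2 w (N * r) (flatten N X) h)"
    and "(\<integral>X. emp_norm2 w (N * r) (flatten N X) h \<partial>\<P>) \<le> beta * hh"
proof -
  note block = PiM_block_integral[OF prob_gamma[OF N] gamma_H_integrable]
  show "integrable \<P> (\<lambda>X. emp_norm2 w (N * r) (flatten N X) h)"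
    unfolding emp_norm2_flatten
    by (rule integrable_mult_right, rule Bochner_Integration.integrable_sum, rule block(1)) simp
  have "(\<integral>X. emp_norm2 w (N * r) (flatten N X) h \<partial>\<P>) =
      (1 / real (N * r)) * (\<Sum>b<r. \<integral>X. (\<Sum>i<N. H (X b i)) \<partial>\<P>)"
    unfolding emp_norm2_flatten integral_mult_right_zero
    by (intro arg_cong2[of _ _ _ _ "(*)"] refl Bochner_Integration.integral_sum block(1)) simp
  also have "\<dots> = (1 / real (N * r)) * (real r * (\<integral>xs. (\<Sum>i<N. H (xs i)) \<partial>\<gamma>))"
    using block(2) by simp
  also have "\<dots> \<le> (1 / real (N * r)) * (real r * (real N * beta * hh))"
    using gamma_H_le by (intro mult_left_mono) auto
  also have "\<dots> = beta * hh" using N_pos r by simp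
  finally show "(\<integral>X. emp_norm2 w (N * r) (flatten N X) h \<partial>\<P>) \<le> beta * hh" .
qed

section \<open>Empirical inner products of the residual with the basis\<close>

lemma integrable_phi_h: "k < m \<Longrightarrow> integrable M (\<lambda>x. \<phi> k x * h x)"
  by (intro integrable_mult_square_integrable \<phi>_L2 h_L2) measurable

text \<open>Unlike for \<open>H\<close>, equality holds everywhere, since \<open>\<phi> k\<close>
  vanishes with \<open>w\<close>.\<close>

lemma w_u: "k < m \<Longrightarrow> w x * u k x = \<phi> k x * h x"
  by (cases "w x = 0") (auto simp: u_def phi_eq_0)

lemma u_meas [measurable]: "k < m \<Longrightarrow> u k \<in> borel_measurable M"
  unfolding u_def by measurable

lemma mean_u: "k < m \<Longrightarrow> mean (u k) = 0"
  by (simp add: mean_def w_u h_orth)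

lemma admissible_u:
  assumes k: "k < m"
  shows "admissible (u k)"
  unfolding admissible_def
proof (intro conjI allI impI)
  show "integrable M (\<lambda>x. w x * u k x)" using k by (simp add: w_u integrable_phi_h)
  fix p q assume pq: "p < m" "q < m"
  show "integrable M (\<lambda>x. u k x * (\<phi> p x * \<phi> q x))"
  proof (rule Bochner_Integration.integrable_bound)
    show "integrable M (\<lambda>x. real m / \<alpha> * (\<phi> k x * h x))" using integrable_phi_h[OF k] by simp
    show "AE x in M. norm (u k x * (\<phi> p x * \<phi> q x)) \<le> norm (real m / \<alpha> * (\<phi> k x * h x))"
    proof (rule AE_I2)
      fix x
      have "\<bar>u k x * (\<phi> p x * \<phi> q x)\<bar> = \<bar>u k x\<bar> * \<bar>\<phi> p x * \<phi> q x\<bar>" by (simp only: abs_mult)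
      also have "\<dots> \<le> \<bar>u k x\<bar> * (real m / \<alpha> * w x)"
        using phi_prod_le[OF pq] by (intro mult_left_mono) auto
      also have "\<dots> = real m / \<alpha> * \<bar>w x * u k x\<bar>" using w_nonneg by (simp add: abs_mult)
      also have "\<dots> = \<bar>real m / \<alpha> * (\<phi> k x * h x)\<bar>" using \<alpha>_pos by (simp add: w_u[OF k] abs_mult)
      finally show "norm (u k x * (\<phi> p x * \<phi> q x)) \<le> norm (real m / \<alpha> * (\<phi> k x * h x))" by simp
    qed
  qed (use k pq in measurable)
qed (use k in measurable)

lemma sum_u_sq_le: "(\<Sum>k<m. (u k x)\<^sup>2) \<le> real m / \<alpha> * H x"
proof (cases "w x = 0")
  case False
  have "(\<Sum>k<m. (u k x)\<^sup>2) = (\<Sum>k<m. (\<phi> k x)\<^sup>2) * ((h x)\<^sup>2 / (w x)\<^sup>2)"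
    by (simp add: u_def sum_distrib_right sum_divide_distrib power_mult_distrib power_divide)
  also have "\<dots> \<le> (real m / \<alpha> * w x) * ((h x)\<^sup>2 / (w x)\<^sup>2)"
    by (intro mult_right_mono sum_phi_sq_le) auto
  also have "\<dots> = real m / \<alpha> * H x"
    using False by (simp add: H_def power2_eq_square)
  finally show ?thesis .
qed (simp add: u_def H_def)

lemma emp_inner_flatten:
  "emp_inner w (N * r) (flatten N X) (\<phi> k) h = (1 / real (N * r)) * (\<Sum>b<r. \<Sum>i<N. u k (X b i))"
  unfolding emp_inner_def mult.assoc u_def[symmetric] sum_flatten ..

text \<open>A pathwise bound: Jensen for the average over the points, then the pointwise estimate
  \<open>sum_u_sq_le\<close> after exchanging the sums.\<close>

lemma sum_emp_inner_sq_le: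
  "(\<Sum>k<m. (emp_inner w n xs (\<phi> k) h)\<^sup>2) \<le> real m / \<alpha> * emp_norm2 w n xs h"
proof (cases "n = 0")
  case False
  have "(\<Sum>k<m. (emp_inner w n xs (\<phi> k) h)\<^sup>2) \<le> (\<Sum>k<m. (1 / real n) * (\<Sum>i<n. (u k (xs i))\<^sup>2))"
  proof (rule sum_mono)
    fix k
    have "(emp_inner w n xs (\<phi> k) h)\<^sup>2 = (1 / real n)\<^sup>2 * (\<Sum>i<n. u k (xs i))\<^sup>2"
      by (simp add: emp_inner_def u_def mult.assoc power_mult_distrib power_divide)
    also have "\<dots> \<le> (1 / real n)\<^sup>2 * ((\<Sum>i<n. (u k (xs i))\<^sup>2) * real (card {..<n}))"
      by (intro mult_left_mono sum_squared_le_sum_of_squares) auto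
    also have "\<dots> = (1 / real n) * (\<Sum>i<n. (u k (xs i))\<^sup>2)"
      using False by (simp add: power2_eq_square)
    finally show "(emp_inner w n xs (\<phi> k) h)\<^sup>2 \<le> (1 / real n) * (\<Sum>i<n. (u k (xs i))\<^sup>2)" .
  qed
  also have "\<dots> = (1 / real n) * (\<Sum>i<n. \<Sum>k<m. (u k (xs i))\<^sup>2)"
    unfolding sum_distrib_left[symmetric] by (subst sum.swap) simp
  also have "\<dots> \<le> (1 / real n) * (\<Sum>i<n. real m / \<alpha> * H (xs i))"
    by (intro mult_left_mono sum_mono sum_u_sq_le) auto
  also have "\<dots> = real m / \<alpha> * emp_norm2 w n xs h"
    unfolding emp_norm2_def H_def by (simp add: sum_distrib_left mult_ac)
  finally show ?thesis .
qed (simp add: emp_inner_def emp_norm2_def)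

text \<open>The equality of \<open>w\<close> with \<open>wm\<close> enters here: the squared basis
  functions then sum to \<open>m * w\<close>, which cancels the \<open>1 / w\<close> in
  \<open>u k\<close> and leaves an integral that is zero by orthogonality.\<close>

lemma trace_moment_u:
  assumes w: "AE x in M. w x = wm \<phi> m x" and k: "k < m"
  shows "(\<Sum>p<m. moment (u k) p p) = 0"
proof -
  have int: "integrable M (\<lambda>x. u k x * (\<phi> p x * \<phi> p x))" if "p < m" for p
    using admissible_u[OF k] that by (simp add: admissible_def)
  have "(\<Sum>p<m. moment (u k) p p) = (\<integral>x. (\<Sum>p<m. u k x * (\<phi> p x * \<phi> p x)) \<partial>M)"
    unfolding moment_def using int by (subst Bochner_Integration.integral_sum) auto
  also have "\<dots> = (\<integral>x. real m * (\<phi> k x * h x) \<partial>M)"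
  proof (rule integral_cong_AE)
    show "AE x in M. (\<Sum>p<m. u k x * (\<phi> p x * \<phi> p x)) = real m * (\<phi> k x * h x)"
      using w
    proof eventually_elim
      case (elim x)
      have "(\<Sum>p<m. u k x * (\<phi> p x * \<phi> p x)) = u k x * (\<Sum>p<m. (\<phi> p x)\<^sup>2)"
        by (simp add: sum_distrib_left power2_eq_square)
      also have "(\<Sum>p<m. (\<phi> p x)\<^sup>2) = real m * w x"
        using elim m_pos by (simp add: wm_def)
      finally show ?case by (simp add: w_u[OF k, symmetric])
    qed
  qed (use k in measurable)
  also have "\<dots> = 0" using h_orth[OF k] by simp
  finally show ?thesis .
qed

lemma gamma_u_sq:
  assumes k: "k < m" and i: "i < N"
  shows "integrable \<gamma> (\<lambda>xs. (u k (xs i))\<^sup>2)"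
proof (rule Bochner_Integration.integrable_bound)
  show "integrable \<gamma> (\<lambda>xs. real m / \<alpha> * H (xs i))"
    using gamma_linear(1)[OF admissible_H i] by simp
  show "AE xs in \<gamma>. norm ((u k (xs i))\<^sup>2) \<le> norm (real m / \<alpha> * H (xs i))"
  proof (rule AE_I2)
    fix xs
    have "(u k (xs i))\<^sup>2 \<le> (\<Sum>k<m. (u k (xs i))\<^sup>2)"
      using k by (intro member_le_sum) auto
    also have "\<dots> \<le> real m / \<alpha> * H (xs i)" by (rule sum_u_sq_le)
    finally show "norm ((u k (xs i))\<^sup>2) \<le> norm (real m / \<alpha> * H (xs i))"
      using H_nonneg[of "xs i"] \<alpha>_pos by (simp add: abs_mult)
  qed
  show "(\<lambda>xs. (u k (xs i))\<^sup>2) \<in> borel_measurable \<gamma>"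
    using gamma_linear(1)[OF admissible_u[OF k] i] by (intro borel_measurable_power) auto
qed

text \<open>For \<open>w = w\<^sub>m\<close> the points of one block are centred for \<open>u k\<close> and negatively correlated.\<close>
lemma gamma_block_variance:
  assumes w: "AE x in M. w x = wm \<phi> m x" and k: "k < m"
  defines "Y \<equiv> \<lambda>xs. \<Sum>i<N. u k (xs i)"
  shows "integrable \<gamma> Y" "integral\<^sup>L \<gamma> Y = 0" "integrable \<gamma> (\<lambda>xs. (Y xs)\<^sup>2)"
    and "(\<integral>xs. (Y xs)\<^sup>2 \<partial>\<gamma>) \<le> (\<integral>xs. (\<Sum>i<N. (u k (xs i))\<^sup>2) \<partial>\<gamma>)"
proof -
  note adm = admissible_u[OF k] and tr = trace_moment_u[OF w k]
  show "integrable \<gamma> Y"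
    unfolding Y_def using gamma_linear(1)[OF adm] by (intro Bochner_Integration.integrable_sum) auto
  show "integral\<^sup>L \<gamma> Y = 0"
    unfolding Y_def gamma_linear(2)[OF adm N] by (simp add: mean_u[OF k] tr)
  have sq: "(Y xs)\<^sup>2 = (\<Sum>i<N. (u k (xs i))\<^sup>2) + (\<Sum>i<N. \<Sum>j\<in>{..<N} - {i}. u k (xs i) * u k (xs j))" for xs
  proof -
    have "(Y xs)\<^sup>2 = (\<Sum>i<N. \<Sum>j<N. u k (xs i) * u k (xs j))"
      by (simp add: Y_def power2_eq_square sum_product)
    also have "\<dots> = (\<Sum>i<N. (u k (xs i))\<^sup>2 + (\<Sum>j\<in>{..<N} - {i}. u k (xs i) * u k (xs j)))"
      by (intro sum.cong refl) (simp add: sum.remove power2_eq_square)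
    finally show ?thesis by (simp add: sum.distrib)
  qed
  note quad = gamma_quadratic[OF adm mean_u[OF k]]
  have int1: "integrable \<gamma> (\<lambda>xs. \<Sum>i<N. (u k (xs i))\<^sup>2)"
    using gamma_u_sq[OF k] by (intro Bochner_Integration.integrable_sum) auto
  have int2: "integrable \<gamma> (\<lambda>xs. \<Sum>j\<in>{..<N} - {i}. u k (xs i) * u k (xs j))" if "i < N" for i
    using quad(1) that by (intro Bochner_Integration.integrable_sum) auto
  have int3: "integrable \<gamma> (\<lambda>xs. \<Sum>i<N. \<Sum>j\<in>{..<N} - {i}. u k (xs i) * u k (xs j))"
    by (rule Bochner_Integration.integrable_sum, rule int2) simp
  show "integrable \<gamma> (\<lambda>xs. (Y xs)\<^sup>2)"
    unfolding sq using int1 int3 by (rule Bochner_Integration.integrable_add)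
  have "(\<integral>xs. (\<Sum>i<N. \<Sum>j\<in>{..<N} - {i}. u k (xs i) * u k (xs j)) \<partial>\<gamma>) =
      (\<Sum>i<N. \<integral>xs. (\<Sum>j\<in>{..<N} - {i}. u k (xs i) * u k (xs j)) \<partial>\<gamma>)"
    by (intro Bochner_Integration.integral_sum int2) simp
  also have "\<dots> = (\<Sum>i<N. \<Sum>j\<in>{..<N} - {i}. \<integral>xs. u k (xs i) * u k (xs j) \<partial>\<gamma>)"
    using quad(1) by (intro sum.cong refl Bochner_Integration.integral_sum) auto
  \<comment> \<open>With zero trace only minus the squared Frobenius norm of the moments is
    left.\<close>
  also have "\<dots> = - (\<Sum>p<m. \<Sum>q<m. (moment (u k) p q)\<^sup>2)"
    unfolding quad(2)[OF N] tr by simp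
  also have "\<dots> \<le> 0" by (simp add: sum_nonneg)
  finally show "(\<integral>xs. (Y xs)\<^sup>2 \<partial>\<gamma>) \<le> (\<integral>xs. (\<Sum>i<N. (u k (xs i))\<^sup>2) \<partial>\<gamma>)"
    unfolding sq Bochner_Integration.integral_add[OF int1 int3] by simp
qed

text \<open>Variances of the \<open>r\<close> independent centred blocks add up, so one of the two
  factors \<open>1 / n\<close> survives; this produces the rate \<open>m / n\<close>.\<close>

lemma sum_emp_inner_sq_expectation:
  assumes w: "AE x in M. w x = wm \<phi> m x"
  defines "T \<equiv> \<lambda>X. \<Sum>k<m. (emp_inner w (N * r) (flatten N X) (\<phi> k) h)\<^sup>2"
  shows "integrable \<P> T" and "integral\<^sup>L \<P> T \<le> real m / real (N * r) * (1 / \<alpha>) * beta * hh"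
proof -
  define Y where "Y k xs = (\<Sum>i<N. u k (xs i))" for k xs
  note var = gamma_block_variance[OF w, folded Y_def]
  note block = PiM_block_square_integral[OF prob_gamma[OF N] var(1,3,2)]
  have T: "T = (\<lambda>X. (1 / real (N * r))\<^sup>2 * (\<Sum>k<m. (\<Sum>b<r. Y k (X b))\<^sup>2))"
    unfolding T_def emp_inner_flatten Y_def power_mult_distrib sum_distrib_left[symmetric] ..
  show "integrable \<P> T"
    unfolding T using block(1) by (intro integrable_mult_right Bochner_Integration.integrable_sum) auto
  have "integral\<^sup>L \<P> T = (1 / real (N * r))\<^sup>2 * (\<Sum>k<m. \<integral>X. (\<Sum>b<r. Y k (X b))\<^sup>2 \<partial>\<P>)"
    unfolding T integral_mult_right_zero using block(1)
    by (subst Bochner_Integration.integral_sum) auto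
  also have "\<dots> = (1 / real (N * r))\<^sup>2 * (\<Sum>k<m. real r * (\<integral>xs. (Y k xs)\<^sup>2 \<partial>\<gamma>))"
    using block(2) by simp
  also have "\<dots> \<le> (1 / real (N * r))\<^sup>2 * (\<Sum>k<m. real r * (\<integral>xs. (\<Sum>i<N. (u k (xs i))\<^sup>2) \<partial>\<gamma>))"
    using var(4) by (intro mult_left_mono sum_mono) auto
  also have "\<dots> = (1 / real (N * r))\<^sup>2 * (real r * (\<integral>xs. (\<Sum>k<m. \<Sum>i<N. (u k (xs i))\<^sup>2) \<partial>\<gamma>))"
    unfolding sum_distrib_left[symmetric] using gamma_u_sq
    by (subst Bochner_Integration.integral_sum) (auto intro!: Bochner_Integration.integrable_sum)
  also have "\<dots> \<le> (1 / real (N * r))\<^sup>2 * (real r * (\<integral>xs. real m / \<alpha> * (\<Sum>i<N. H (xs i)) \<partial>\<gamma>))"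
  proof (intro mult_left_mono integral_mono)
    show "integrable \<gamma> (\<lambda>xs. \<Sum>k<m. \<Sum>i<N. (u k (xs i))\<^sup>2)"
      using gamma_u_sq by (intro Bochner_Integration.integrable_sum) auto
    show "integrable \<gamma> (\<lambda>xs. real m / \<alpha> * (\<Sum>i<N. H (xs i)))"
      using gamma_H_integrable by simp
    show "(\<Sum>k<m. \<Sum>i<N. (u k (xs i))\<^sup>2) \<le> real m / \<alpha> * (\<Sum>i<N. H (xs i))" for xs
      unfolding sum_distrib_left by (subst sum.swap) (intro sum_mono sum_u_sq_le)
  qed auto
  also have "\<dots> \<le> (1 / real (N * r))\<^sup>2 * (real r * (real m / \<alpha> * (real N * beta * hh)))"
    unfolding integral_mult_right_zero using gamma_H_le \<alpha>_pos
    by (intro mult_left_mono) auto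
  also have "\<dots> = real m / real (N * r) * (1 / \<alpha>) * beta * hh"
    using N_pos r by (simp add: power2_eq_square field_simps)
  finally show "integral\<^sup>L \<P> T \<le> real m / real (N * r) * (1 / \<alpha>) * beta * hh" .
qed

end

section \<open>Orthogonal projection in the space of square-integrable functions\<close>

context weighted_onb
begin

text \<open>Pythagoras: the error of any element of \<open>Vm\<close> is that of the projection plus
  the squared coefficient distance, so the infimum and the error of the estimator both reduce to
  coefficients.\<close>

lemma best_approximation:
  assumes f [measurable]: "f \<in> borel_measurable M" and f_L2: "integrable M (\<lambda>x. (f x)\<^sup>2)"
  defines "p \<equiv> \<lambda>k. \<integral>x. \<phi> k x * f x \<partial>M"
  defines "h \<equiv> \<lambda>x. f x - (\<Sum>k<m. p k * \<phi> k x)"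
  shows "h \<in> borel_measurable M" "integrable M (\<lambda>x. (h x)\<^sup>2)"
    and "\<And>k. k < m \<Longrightarrow> (\<integral>x. \<phi> k x * h x \<partial>M) = 0"
    and "\<And>c. L2sq M (\<lambda>x. f x - (\<Sum>k<m. c k * \<phi> k x)) = (\<integral>x. (h x)\<^sup>2 \<partial>M) + (\<Sum>k<m. (c k - p k)\<^sup>2)"
proof -
  have phi_f: "integrable M (\<lambda>x. \<phi> k x * f x)" if "k < m" for k
    using that by (intro integrable_mult_square_integrable \<phi>_L2 f_L2) measurable
  show h_meas [measurable]: "h \<in> borel_measurable M" unfolding h_def by measurable
  have comb_sq: "(\<lambda>x. (\<Sum>k<m. d k * \<phi> k x)\<^sup>2) = (\<lambda>x. \<Sum>k<m. \<Sum>l<m. d k * d l * (\<phi> k x * \<phi> l x))" for d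
    by (simp add: power2_eq_square sum_product mult_ac)
  have comb_int: "integrable M (\<lambda>x. (\<Sum>k<m. d k * \<phi> k x)\<^sup>2)" for d
    unfolding comb_sq by (intro Bochner_Integration.integrable_sum integrable_mult_right integrable_phi_prod) auto
  have comb: "(\<integral>x. (\<Sum>k<m. d k * \<phi> k x)\<^sup>2 \<partial>M) = (\<Sum>k<m. (d k)\<^sup>2)" for d
  proof -
    have "(\<integral>x. (\<Sum>k<m. d k * \<phi> k x)\<^sup>2 \<partial>M) = (\<Sum>k<m. \<integral>x. (\<Sum>l<m. d k * d l * (\<phi> k x * \<phi> l x)) \<partial>M)"
      unfolding comb_sq
      by (intro Bochner_Integration.integral_sum Bochner_Integration.integrable_sum integrable_mult_right integrable_phi_prod) auto
    also have "\<dots> = (\<Sum>k<m. \<Sum>l<m. d k * d l * (if k = l then 1 else 0))"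
      using integrable_phi_prod \<phi>_orth
      by (intro sum.cong refl, subst Bochner_Integration.integral_sum) auto
    also have "\<dots> = (\<Sum>k<m. (d k)\<^sup>2)"
      by (simp add: power2_eq_square if_distrib[of "\<lambda>x. _ * x"] cong: if_cong)
    finally show ?thesis .
  qed
  have f_comb: "integrable M (\<lambda>x. f x * (\<Sum>k<m. p k * \<phi> k x))"
    by (intro integrable_mult_square_integrable f_L2 comb_int) measurable
  have "(\<lambda>x. (h x)\<^sup>2) = (\<lambda>x. (f x)\<^sup>2 - 2 * (f x * (\<Sum>k<m. p k * \<phi> k x)) + (\<Sum>k<m. p k * \<phi> k x)\<^sup>2)"
    by (auto simp: h_def power2_diff fun_eq_iff)
  then show h_L2: "integrable M (\<lambda>x. (h x)\<^sup>2)"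
    using f_L2 f_comb comb_int by simp
  show orth: "(\<integral>x. \<phi> k x * h x \<partial>M) = 0" if k: "k < m" for k
  proof -
    have "(\<lambda>x. \<phi> k x * h x) = (\<lambda>x. \<phi> k x * f x - (\<Sum>l<m. p l * (\<phi> k x * \<phi> l x)))"
      by (simp add: h_def right_diff_distrib sum_distrib_left mult_ac)
    moreover have "(\<integral>x. (\<Sum>l<m. p l * (\<phi> k x * \<phi> l x)) \<partial>M) = (\<Sum>l<m. p l * (if k = l then 1 else 0))"
      using k integrable_phi_prod \<phi>_orth by (subst Bochner_Integration.integral_sum) auto
    moreover have "(\<Sum>l<m. p l * (if k = l then 1 else 0)) = p k"
      using k by (simp add: if_distrib[of "\<lambda>x. _ * x"] cong: if_cong)
    moreover have "integrable M (\<lambda>x. \<Sum>l<m. p l * (\<phi> k x * \<phi> l x))"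
      using k by (intro Bochner_Integration.integrable_sum integrable_mult_right integrable_phi_prod) auto
    ultimately show ?thesis using phi_f[OF k] by (simp add: p_def)
  qed
  show "L2sq M (\<lambda>x. f x - (\<Sum>k<m. c k * \<phi> k x)) = (\<integral>x. (h x)\<^sup>2 \<partial>M) + (\<Sum>k<m. (c k - p k)\<^sup>2)" for c
  proof -
    define d where "d k = c k - p k" for k
    have phi_h: "integrable M (\<lambda>x. \<phi> k x * h x)" if "k < m" for k
      using that h_meas by (intro integrable_mult_square_integrable \<phi>_L2 h_L2) measurable
    have cross: "integrable M (\<lambda>x. \<Sum>k<m. d k * (\<phi> k x * h x))"
      using phi_h by (intro Bochner_Integration.integrable_sum) auto
    have cross0: "(\<integral>x. (\<Sum>k<m. d k * (\<phi> k x * h x)) \<partial>M) = 0"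
      using phi_h orth by (subst Bochner_Integration.integral_sum) auto
    have "(f x - (\<Sum>k<m. c k * \<phi> k x))\<^sup>2 =
        (h x)\<^sup>2 - 2 * (\<Sum>k<m. d k * (\<phi> k x * h x)) + (\<Sum>k<m. d k * \<phi> k x)\<^sup>2" for x
    proof -
      have "f x - (\<Sum>k<m. c k * \<phi> k x) = h x - (\<Sum>k<m. d k * \<phi> k x)"
        by (simp add: h_def d_def left_diff_distrib sum_subtractf)
      moreover have "(\<Sum>k<m. d k * (\<phi> k x * h x)) = (\<Sum>k<m. d k * \<phi> k x) * h x"
        by (simp add: sum_distrib_right mult.assoc)
      ultimately show ?thesis by (simp add: power2_diff mult_ac)
    qed
    then show ?thesis
      unfolding L2sq_def using h_L2 cross cross0 comb_int comb by (simp add: d_def)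
  qed
qed

end

section \<open>The two conditional error bounds\<close>

theorem mainTheorem17:
  fixes M :: "'a :: polish_space measure"
    and \<phi> :: "nat \<Rightarrow> 'a \<Rightarrow> real" and w f :: "'a \<Rightarrow> real"
    and m r nbar :: nat and \<alpha> \<delta> :: real
  assumes M: "prob_space M" "sets M = sets borel"
    and m_pos: "m > 0"
    and \<phi>_meas: "\<And>i. i < m \<Longrightarrow> \<phi> i \<in> borel_measurable M"
    and \<phi>_L2: "\<And>i. i < m \<Longrightarrow> integrable M (\<lambda>x. (\<phi> i x)\<^sup>2)"
    and \<phi>_orth: "\<And>i j. i < m \<Longrightarrow> j < m \<Longrightarrow>
        (\<integral>x. \<phi> i x * \<phi> j x \<partial>M) = (if i = j then 1 else 0)"
    and w_meas: "w \<in> borel_measurable M"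
    and w_nonneg: "\<And>x. x \<in> space M \<Longrightarrow> w x \<ge> 0"
    and w_int: "integrable M w" and w_one: "(\<integral>x. w x \<partial>M) = 1"
    and \<alpha>: "0 < \<alpha>" "\<alpha> \<le> 1"
    and w_ge: "\<And>x. x \<in> space M \<Longrightarrow> w x \<ge> \<alpha> * wm \<phi> m x"
    and nbar: "nbar \<ge> m"
    and \<delta>: "0 < \<delta>" "\<delta> < 1"
    and f_meas: "f \<in> borel_measurable M"
    and f_L2: "integrable M (\<lambda>x. (f x)\<^sup>2)"
  defines "n \<equiv> nbar * r"
  defines "P \<equiv> PiM {..<r} (\<lambda>_. gamma_vs M \<phi> m w nbar)"
  defines "S \<equiv> {X \<in> space P. lambda_min (Gram \<phi> m w n (flatten nbar X)) \<ge> 1 - \<delta>}"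
    and "\<beta> \<equiv> 1 + (1 / \<alpha> - 1) * real m / real nbar"
    and "\<xi> \<equiv> (if density M w = density M (wm \<phi> m) then 0 else 1 :: real)"
  defines "E \<equiv> cond_exp_event P S (\<lambda>X. L2sq M (\<lambda>x. f x - wls \<phi> m w n (flatten nbar X) f x))"
    and "best \<equiv> (INF g \<in> Vm \<phi> m. L2sq M (\<lambda>x. f x - g x))"
  assumes PS: "measure P S > 0"
  shows "E \<le> ennreal ((1 + (1 / measure P S) * (1 / (1 - \<delta>)) * \<beta>) * best) \<and>
         E \<le> ennreal ((1 + (1 / measure P S) * (1 / (1 - \<delta>))\<^sup>2 * (real m / real n) * (1 / \<alpha>)
              * (\<beta> + \<xi> * real m * (1 / \<alpha>) + \<beta> * \<xi> * real n)) * best)"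
proof -
  have sp: "space M = UNIV" using sets_eq_imp_space_eq[OF M(2)] by simp
  interpret weighted_onb M \<phi> w m \<alpha>
    by (intro weighted_onb.intro M(1) m_pos \<phi>_meas \<phi>_L2 \<phi>_orth w_meas w_nonneg w_int w_one \<alpha>(1) w_ge)
       (simp_all add: sp)
  define p where "p k = (\<integral>x. \<phi> k x * f x \<partial>M)" for k
  define h where "h x = f x - (\<Sum>k<m. p k * \<phi> k x)" for x
  note proj = best_approximation[OF f_meas f_L2, folded p_def, folded h_def]
  \<comment> \<open>Without sample points the Gram matrix is zero and, tested on the constant
    vector, its \<open>lambda_min\<close> is at most 0; then \<open>S\<close> would be empty,
    against \<open>PS\<close>.\<close>
  have r: "r > 0"
  proof (rule ccontr)
    assume "\<not> r > 0"
    then have n0: "n = 0" by (simp add: n_def)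
    have le0: "lambda_min (Gram \<phi> m w n xs) \<le> 0" for xs
    proof -
      have "lambda_min (Gram \<phi> m w n xs) * (\<Sum>k<m. (1::real)\<^sup>2) \<le> quad_form (Gram \<phi> m w n xs) m (\<lambda>_. 1)"
        by (rule quad_form_ge_lambda_min[OF Gram_carrier Gram_sym])
      also have "\<dots> = 0" by (simp add: quad_form_Gram emp_norm2_def n0)
      finally show ?thesis using m_pos by (simp add: mult_le_0_iff)
    qed
    have "X \<notin> S" for X using le0[of "flatten nbar X"] \<delta> by (simp add: S_def)
    then have "S = {}" by blast
    then show False using PS by simp
  qed
  interpret weighted_onb_residual M \<phi> w m \<alpha> h nbar r
    by (intro weighted_onb_residual.intro weighted_onb_residual_axioms.intro weighted_onb_axioms
          proj(1-3) nbar r)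
  have beta: "\<beta> = beta" by (simp add: \<beta>_def beta_def)
  have beta_nonneg: "beta \<ge> 0" using \<alpha> by (simp add: beta_def)
  have P: "prob_space P" unfolding P_def by (intro prob_space_PiM prob_gamma nbar)
  \<comment> \<open>\<open>measure\<close> is 0 off the measurable sets, so positivity of
    \<open>measure P S\<close> already yields measurability.\<close>
  have S: "S \<in> sets P" using PS measure_notin_sets[of S P] by force
  have best: "hh \<le> best"
    unfolding best_def
  proof (rule cINF_greatest)
    show "Vm \<phi> m \<noteq> {}" by (auto simp: Vm_def)
    fix g assume "g \<in> Vm \<phi> m"
    then obtain c where "g = (\<lambda>x. \<Sum>k<m. c k * \<phi> k x)" by (auto simp: Vm_def)
    then show "hh \<le> L2sq M (\<lambda>x. f x - g x)" by (simp add: proj(4) sum_nonneg)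
  qed
  have err: "L2sq M (\<lambda>x. f x - wls \<phi> m w n (flatten nbar X) f x) \<le>
        hh + 1 / (1 - \<delta>) * emp_norm2 w n (flatten nbar X) h"
      "L2sq M (\<lambda>x. f x - wls \<phi> m w n (flatten nbar X) f x) \<le>
        hh + (1 / (1 - \<delta>))\<^sup>2 * (\<Sum>k<m. (emp_inner w n (flatten nbar X) (\<phi> k) h)\<^sup>2)" if "X \<in> S" for X
  proof -
    have "lambda_min (Gram \<phi> m w n (flatten nbar X)) \<ge> 1 - \<delta>" "1 - \<delta> > 0"
      using that \<delta> by (auto simp: S_def)
    then obtain c where "wls \<phi> m w n (flatten nbar X) f = (\<lambda>x. \<Sum>k<m. c k * \<phi> k x)"
      and "(\<Sum>k<m. (c k - p k)\<^sup>2) \<le> (1 / (1 - \<delta>)) * emp_norm2 w n (flatten nbar X) h"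
      and "(\<Sum>k<m. (c k - p k)\<^sup>2) \<le> (1 / (1 - \<delta>))\<^sup>2 * (\<Sum>k<m. (emp_inner w n (flatten nbar X) (\<phi> k) h)\<^sup>2)"
      by (rule wls_error_bounds[where f = f and h = h and p = p, rotated])
         (auto simp: h_def w_nonneg sp)
    then show "L2sq M (\<lambda>x. f x - wls \<phi> m w n (flatten nbar X) f x) \<le>
        hh + 1 / (1 - \<delta>) * emp_norm2 w n (flatten nbar X) h"
      "L2sq M (\<lambda>x. f x - wls \<phi> m w n (flatten nbar X) f x) \<le>
        hh + (1 / (1 - \<delta>))\<^sup>2 * (\<Sum>k<m. (emp_inner w n (flatten nbar X) (\<phi> k) h)\<^sup>2)"
      by (simp_all add: proj(4))
  qed
  \<comment> \<open>Scheme shared by all cases: \<open>T\<close> dominates the excess error on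
    \<open>S\<close> with factor \<open>K\<close>, and \<open>\<tau>\<close> bounds its
    unconditional mean in units of \<open>hh\<close>.\<close>
  have bound: "E \<le> ennreal ((1 + (1 / measure P S) * C) * best)"
    if T: "integrable P T" "\<And>X. T X \<ge> 0" "integral\<^sup>L P T \<le> \<tau> * hh" and \<tau>: "\<tau> \<ge> 0" and K: "K \<ge> 0"
      and Z: "\<And>X. X \<in> S \<Longrightarrow> L2sq M (\<lambda>x. f x - wls \<phi> m w n (flatten nbar X) f x) \<le> hh + K * T X"
      and C: "K * \<tau> \<le> C" for T \<tau> K C
  proof -
    have "E \<le> ennreal (hh + (1 / measure P S) * K * (\<tau> * hh))"
      unfolding E_def using T K Z by (intro cond_exp_event_le[OF P S PS]) auto
    also have "hh + (1 / measure P S) * K * (\<tau> * hh) = (1 + (1 / measure P S) * (K * \<tau>)) * hh"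
      by (simp add: algebra_simps)
    also have "\<dots> \<le> (1 + (1 / measure P S) * C) * best"
      using C best PS order.trans[OF mult_nonneg_nonneg[OF K \<tau>] C]
      by (intro mult_mono add_mono mult_left_mono add_nonneg_nonneg mult_nonneg_nonneg) auto
    finally show ?thesis using ennreal_leI order.trans by blast
  qed
  note expect = emp_norm2_expectation[folded n_def, folded P_def]
  have norm_nonneg: "emp_norm2 w n (flatten nbar X) h \<ge> 0" for X
    by (rule emp_norm2_nonneg) (simp add: w_nonneg sp)
  have first: "E \<le> ennreal ((1 + (1 / measure P S) * (1 / (1 - \<delta>) * \<beta>)) * best)"
    using \<delta> beta_nonneg unfolding beta
    by (intro bound[OF expect(1) norm_nonneg expect(2) _ _ err(1)]) auto
  have n_pos: "n > 0" using r nbar m_pos by (simp add: n_def)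
  have second: "E \<le> ennreal ((1 + (1 / measure P S) * ((1 / (1 - \<delta>))\<^sup>2 *
      (real m / real n * (1 / \<alpha>) * (\<beta> + \<xi> * real m * (1 / \<alpha>) + \<beta> * \<xi> * real n)))) * best)"
  proof (cases "density M w = density M (wm \<phi> m)")
    case True
    have meas: "wm \<phi> m \<in> borel_measurable M" unfolding wm_def using \<phi>_meas by measurable
    interpret prob_space M by fact
    \<comment> \<open>Densities are unique up to null sets; both functions are nonnegative, so
      passing through \<open>ennreal\<close> loses nothing.\<close>
    have "AE x in M. ennreal (w x) = ennreal (wm \<phi> m x)"
      using True w_meas meas by (subst (asm) density_unique_iff) auto
    then have w_eq: "AE x in M. w x = wm \<phi> m x"
    proof eventually_elim
      case (elim x)
      then show ?case using w_nonneg[of x] by (simp add: sp wm_def sum_nonneg)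
    qed
    note T = sum_emp_inner_sq_expectation[OF w_eq, folded n_def, folded P_def]
    show ?thesis
      using beta_nonneg \<alpha> True unfolding beta
      by (intro bound[OF T(1) _ T(2) _ _ err(2)] mult_left_mono) (auto simp: \<xi>_def sum_nonneg)
  next
    case False
    then have \<xi>: "\<xi> = 1" by (simp add: \<xi>_def)
    have c: "real m / \<alpha> \<ge> 0" using \<alpha> by simp
    show ?thesis
    \<comment> \<open>By \<open>sum_emp_inner_sq_le\<close> the squared inner products are dominated
      by this multiple of the empirical norm, whose mean is already bounded.\<close>
    proof (rule bound[where T = "\<lambda>X. real m / \<alpha> * emp_norm2 w n (flatten nbar X) h" and \<tau> = "real m / \<alpha> * beta"])
      show "integrable P (\<lambda>X. real m / \<alpha> * emp_norm2 w n (flatten nbar X) h)"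
        using expect(1) by simp
      show "real m / \<alpha> * emp_norm2 w n (flatten nbar X) h \<ge> 0" for X
        using c norm_nonneg by (rule mult_nonneg_nonneg)
      show "(\<integral>X. real m / \<alpha> * emp_norm2 w n (flatten nbar X) h \<partial>P) \<le> real m / \<alpha> * beta * hh"
        unfolding integral_mult_right_zero mult.assoc using c expect(2) by (intro mult_left_mono)
      show "real m / \<alpha> * beta \<ge> 0" using c beta_nonneg by (rule mult_nonneg_nonneg)
      show "(1 / (1 - \<delta>))\<^sup>2 \<ge> 0" by simp
      show "L2sq M (\<lambda>x. f x - wls \<phi> m w n (flatten nbar X) f x) \<le>
          hh + (1 / (1 - \<delta>))\<^sup>2 * (real m / \<alpha> * emp_norm2 w n (flatten nbar X) h)" if "X \<in> S" for X
        by (rule order.trans[OF err(2)[OF that]]) (intro add_left_mono mult_left_mono sum_emp_inner_sq_le, simp)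
      \<comment> \<open>In the summand \<open>\<beta> * \<xi> * n\<close> the factor
        \<open>n\<close> cancels the prefactor \<open>1 / n\<close>; the other two summands are
        nonnegative.\<close>
      have "real m / \<alpha> * beta = real m / real n * (1 / \<alpha>) * (\<beta> * \<xi> * real n)"
        using n_pos by (simp add: beta \<xi>)
      also have "\<dots> \<le> real m / real n * (1 / \<alpha>) * (\<beta> + \<xi> * real m * (1 / \<alpha>) + \<beta> * \<xi> * real n)"
        using \<alpha> beta_nonneg by (intro mult_left_mono) (auto simp: beta \<xi>)
      finally show "(1 / (1 - \<delta>))\<^sup>2 * (real m / \<alpha> * beta) \<le> (1 / (1 - \<delta>))\<^sup>2 *
          (real m / real n * (1 / \<alpha>) * (\<beta> + \<xi> * real m * (1 / \<alpha>) + \<beta> * \<xi> * real n))"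
        by (intro mult_left_mono) auto
    qed
  qed
  show ?thesis using first second by (simp only: mult.assoc)
qed

end
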